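(* For each quasi-periodic labelling $\rho$, the group $G_\rho$ is not finitely presentable.
   Context: Maps act on the right: $x\cdot f$ is the image of $x$ under $f$, and $fg$ means first $f$, then $g$. $\mathrm{Supp}(f)=\{x : x\cdot f\neq x\}$. Thompson's group $F$ is the group of piecewise linear orientation-preserving homeomorphisms of $[0,1]$ that are differentiable except at finitely many dyadic rationals and whose derivatives, where they exist, are integer powers of $2$; $F'=[F,F]$. For dyadic rationals $0\le r<s\le 1$, $F_{[r,s]}$ is the subgroup of elements of $F$ with support in $[r,s]$. Let $\iota_0$ be the map $t\mapsto 1-t$ of $[0,1]$. Fix $c_0\in F$ with $\mathrm{Supp}(c_0)=(0,\tfrac14)$, $x\cdot c_0>x$ for all $x\in(0,\tfrac14)$, and $t\cdot c_0=2t$ for $t\in(0,\tfrac1{16})$. Put $c_1=\iota_0 c_0\iota_0$ and $\nu_1=c_0c_1$. Fix homeomorphisms $\nu_2,\nu_3$ of $[0,1]$ with supports in $(\tfrac1{16},\tfrac{15}{16})$ that generate $F_{[1/16,15/16]}$. Let $H=\langle F',\nu_1\rangle=\langle \nu_1,\nu_2,\nu_3\rangle$. A labelling is a map $\rho:\tfrac12\mathbf{Z}\to\{a,b,a^{-1},b^{-1}\}$ with $\rho(k)\in\{a,a^{-1}\}$ for $k\in\mathbf{Z}$ and $\rho(k)\in\{b,b^{-1}\}$ for $k\in\tfrac12\mathbf{Z}\setminus\mathbf{Z}$. A block is a set $X=\{k,k+\tfrac12,\ldots,k+\tfrac12 n\}$ with $k\in\tfrac12\mathbf{Z}$, $n\in\mathbf{N}$;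 its word is $W_\rho(X)=\rho(k)\rho(k+\tfrac12)\cdots\rho(k+\tfrac12n)$, and $W_\rho^{-1}(X)$ is the formal inverse word (reverse the order and invert each letter). The labelling $\rho$ is quasi-periodic if (1) for each block $X$ there is $n\in\mathbf{N}$ such that for every block $Y$ of size at least $n$, $W_\rho(X)$ is a subword (string of consecutive letters) of $W_\rho(Y)$; and (2) for each block $X$ there is a block $Y$ with $W_\rho(Y)=W_\rho^{-1}(X)$. For a labelling $\rho$ and $i\in\{1,2,3\}$ define homeomorphisms $\zeta_i,\chi_i$ of $\mathbf{R}$ by: for $n\in\mathbf{Z}$, $t\in[0,1]$, $(n+t)\cdot\zeta_i=n+t\cdot\nu_i$ if $\rho(n+\tfrac12)=b$ and $(n+t)\cdot\zeta_i=n+t\cdot(\iota_0\nu_i\iota_0)$ if $\rho(n+\tfrac12)=b^{-1}$; $(n-\tfrac12+t)\cdot\chi_i=n-\tfrac12+t\cdot\nu_i$ if $\rho(n)=a$ and $(n-\tfrac12+t)\cdot\chi_i=n-\tfrac12+t\cdot(\iota_0\nu_i\iota_0)$ if $\rho(n)=a^{-1}$. Then $G_\rho=\langle\zeta_1,\zeta_2,\zeta_3,\chi_1,\chi_2,\chi_3\rangle<\mathrm{Homeo}^+(\mathbf{R})$. *)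

theory Defs
  imports "HOL-Analysis.Analysis" "HOL-Algebra.Elementary_Groups" "HOL-Library.Sublist"
begin

section \<open>Words, free groups and finite presentability\<close>

datatype 'a letter = Pos 'a | Neg 'a

fun gen_of :: "'a letter \<Rightarrow> 'a" where
  "gen_of (Pos x) = x"
| "gen_of (Neg x) = x"

fun inv_letter :: "'a letter \<Rightarrow> 'a letter" where
  "inv_letter (Pos x) = Neg x"
| "inv_letter (Neg x) = Pos x"

definition inv_word :: "'a letter list \<Rightarrow> 'a letter list" where
  "inv_word w = rev (map inv_letter w)"

fun reduced_word :: "'a letter list \<Rightarrow> bool" where
  "reduced_word (l # m # w) \<longleftrightarrow> m \<noteq> inv_letter l \<and> reduced_word (m # w)"
| "reduced_word _ \<longleftrightarrow> True"

text \<open>Prepend a letter to a reduced word, cancelling it against the first letter if possible.\<close>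

fun push_letter :: "'a letter \<Rightarrow> 'a letter list \<Rightarrow> 'a letter list" where
  "push_letter l [] = [l]"
| "push_letter l (m # w) = (if m = inv_letter l then w else l # m # w)"

definition reduce_word :: "'a letter list \<Rightarrow> 'a letter list" where
  "reduce_word w = foldr push_letter w []"

definition free_group :: "'a set \<Rightarrow> 'a letter list monoid" where
  "free_group S =
    \<lparr>carrier = {w. gen_of ` set w \<subseteq> S \<and> reduced_word w},
     mult = \<lambda>u v. reduce_word (u @ v),
     one = []\<rparr>"

definition normal_closure :: "('a, 'b) monoid_scheme \<Rightarrow> 'a set \<Rightarrow> 'a set" where
  "normal_closure G R =
     generate G (\<Union>g\<in>carrier G. \<Union>r\<in>R. {g \<otimes>\<^bsub>G\<^esub> r \<otimes>\<^bsub>G\<^esub> inv\<^bsub>G\<^esub> g})"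

text \<open>As a finite presentation only involves a finite generating set, that set may be
  taken to be an initial segment of the natural numbers.\<close>

definition finitely_presentable :: "('a, 'b) monoid_scheme \<Rightarrow> bool" where
  "finitely_presentable G \<longleftrightarrow>
     (\<exists>(n::nat) R. finite R \<and> R \<subseteq> carrier (free_group {..<n}) \<and>
        G \<cong> (free_group {..<n} Mod normal_closure (free_group {..<n}) R))"

lemma inv_letter_inv_letter [simp]: "inv_letter (inv_letter l) = l"
  by (cases l) auto

lemma gen_of_inv_letter [simp]: "gen_of (inv_letter l) = gen_of l"
  by (cases l) auto

lemma reduced_ConsD: "reduced_word (l # w) \<Longrightarrow> reduced_word w"
  by (cases w) auto

lemma reduced_push_letter: "reduced_word w \<Longrightarrow> reduced_word (push_letter l w)"
  by (cases w) (auto dest: reduced_ConsD)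

lemma reduced_foldr_push: "reduced_word v \<Longrightarrow> reduced_word (foldr push_letter u v)"
  by (induction u) (auto intro: reduced_push_letter)

lemma reduced_reduce_word: "reduced_word (reduce_word w)"
  unfolding reduce_word_def by (rule reduced_foldr_push) simp

lemma push_letter_cancel:
  assumes "reduced_word w" shows "push_letter l (push_letter (inv_letter l) w) = w"
proof (cases w)
  case (Cons m v)
  then show ?thesis using assms by (cases v) auto
qed simp

lemma foldr_push_push_letter:
  "reduced_word v \<Longrightarrow> foldr push_letter (push_letter l u) v = push_letter l (foldr push_letter u v)"
proof (cases u)
  case (Cons m w)
  assume "reduced_word v"
  then show ?thesis
    using Cons push_letter_cancel[OF reduced_foldr_push, of v l w] by auto
qed simp

lemma foldr_push_reduce_word:
  "reduced_word v \<Longrightarrow> foldr push_letter (reduce_word u) v = foldr push_letter u v"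
  by (induction u) (simp_all add: reduce_word_def foldr_push_push_letter)

lemma reduce_word_append: "reduce_word (u @ v) = foldr push_letter u (reduce_word v)"
  by (simp add: reduce_word_def)

lemma reduce_word_reduced: "reduced_word w \<Longrightarrow> reduce_word w = w"
proof (induction w)
  case (Cons l w)
  then have "reduce_word (l # w) = push_letter l w"
    using reduced_ConsD by (fastforce simp: reduce_word_def)
  then show ?case using Cons.prems by (cases w) auto
qed (simp add: reduce_word_def)

lemma set_push_letter: "set (push_letter l w) \<subseteq> insert l (set w)"
  by (cases w) auto

lemma set_reduce_word: "set (reduce_word w) \<subseteq> set w"
proof (induction w)
  case (Cons l w)
  then show ?case using set_push_letter[of l "reduce_word w"]
    by (auto simp: reduce_word_def)
qed (simp add: reduce_word_def)

lemma reduce_inv_word_append: "reduce_word (inv_word w @ w) = []"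
proof (induction w)
  case (Cons l w)
  have "reduce_word (inv_word (l # w) @ l # w)
      = foldr push_letter (inv_word w) (push_letter (inv_letter l) (push_letter l (reduce_word w)))"
    by (simp add: inv_word_def reduce_word_def)
  also have "\<dots> = foldr push_letter (inv_word w) (reduce_word w)"
    using push_letter_cancel[OF reduced_reduce_word, of "inv_letter l" w] by simp
  finally show ?case using Cons by (simp add: reduce_word_append)
qed (simp add: reduce_word_def inv_word_def)

lemma group_free_group: "group (free_group S)"
proof (rule groupI)
  fix u v w
  assume u: "u \<in> carrier (free_group S)" and v: "v \<in> carrier (free_group S)"
    and w: "w \<in> carrier (free_group S)"
  show "u \<otimes>\<^bsub>free_group S\<^esub> v \<in> carrier (free_group S)"
    using u v set_reduce_word[of "u @ v"] reduced_reduce_word[of "u @ v"]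
    by (fastforce simp: free_group_def)
  show "u \<otimes>\<^bsub>free_group S\<^esub> v \<otimes>\<^bsub>free_group S\<^esub> w = u \<otimes>\<^bsub>free_group S\<^esub> (v \<otimes>\<^bsub>free_group S\<^esub> w)"
  proof -
    have "reduced_word w" using w by (simp add: free_group_def)
    then have "reduce_word (reduce_word (u @ v) @ w) = foldr push_letter (u @ v) w"
      by (simp only: reduce_word_append[of _ w] reduce_word_reduced foldr_push_reduce_word)
    also have "\<dots> = reduce_word (u @ reduce_word (v @ w))"
      using \<open>reduced_word w\<close>
      by (simp add: reduce_word_append reduce_word_reduced reduced_foldr_push)
    finally show ?thesis by (simp add: free_group_def)
  qed
next
  show "\<one>\<^bsub>free_group S\<^esub> \<in> carrier (free_group S)" by (simp add: free_group_def)
next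
  fix u assume u: "u \<in> carrier (free_group S)"
  show "\<one>\<^bsub>free_group S\<^esub> \<otimes>\<^bsub>free_group S\<^esub> u = u"
    using u by (simp add: free_group_def reduce_word_reduced)
  let ?v = "reduce_word (inv_word u)"
  have "set ?v \<subseteq> inv_letter ` set u"
    using set_reduce_word[of "inv_word u"] by (simp add: inv_word_def)
  then have "gen_of ` set ?v \<subseteq> gen_of ` set u"
    by (force simp: subset_iff)
  then have "?v \<in> carrier (free_group S)"
    using u reduced_reduce_word[of "inv_word u"] by (auto simp: free_group_def)
  moreover have "?v \<otimes>\<^bsub>free_group S\<^esub> u = \<one>\<^bsub>free_group S\<^esub>"
    using u reduce_inv_word_append[of u]
    by (simp add: free_group_def reduce_word_append foldr_push_reduce_word reduced_reduce_word)
  ultimately show "\<exists>v\<in>carrier (free_group S). v \<otimes>\<^bsub>free_group S\<^esub> u = \<one>\<^bsub>free_group S\<^esub>"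
    by blast
qed

lemma (in group) normal_normal_closure:
  assumes R: "R \<subseteq> carrier G" shows "normal_closure G R \<lhd> G"
  unfolding normal_closure_def
proof (rule normal_generateI)
  show "(\<Union>g\<in>carrier G. \<Union>r\<in>R. {g \<otimes> r \<otimes> inv g}) \<subseteq> carrier G"
    using R by auto
next
  fix h g
  assume h: "h \<in> (\<Union>g\<in>carrier G. \<Union>r\<in>R. {g \<otimes> r \<otimes> inv g})" and g: "g \<in> carrier G"
  from h obtain k r where k: "k \<in> carrier G" and r: "r \<in> R" and "h = k \<otimes> r \<otimes> inv k" by auto
  then have "g \<otimes> h \<otimes> inv g = (g \<otimes> k) \<otimes> r \<otimes> inv (g \<otimes> k)"
    using g R by (auto simp: inv_mult_group m_assoc subset_iff)
  with k r g show "g \<otimes> h \<otimes> inv g \<in> (\<Union>g\<in>carrier G. \<Union>r\<in>R. {g \<otimes> r \<otimes> inv g})"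
    by (metis (no_types, lifting) UN_iff m_closed singletonI)
qed


section \<open>Groups of homeomorphisms\<close>

text \<open>Maps act on the right: the product of \<open>f\<close> and \<open>g\<close> is first \<open>f\<close>, then \<open>g\<close>.
  Maps of \<open>S\<close> are represented by functions that are extensional on \<open>S\<close>, as in
  \<^term>\<open>BijGroup S\<close>.\<close>

definition homeo :: "real set \<Rightarrow> (real \<Rightarrow> real) monoid" where
  "homeo S =
    \<lparr>carrier = {f \<in> extensional S. \<exists>g. homeomorphism S S f g},
     mult = \<lambda>f g. compose S g f,
     one = (\<lambda>x\<in>S. x)\<rparr>"

definition homeo_plus :: "real set \<Rightarrow> (real \<Rightarrow> real) monoid" where
  "homeo_plus S = (homeo S)\<lparr>carrier := {f \<in> carrier (homeo S). strict_mono_on S f}\<rparr>"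

definition supp :: "real set \<Rightarrow> (real \<Rightarrow> real) \<Rightarrow> real set" where
  "supp S f = {x \<in> S. f x \<noteq> x}"

lemma group_homeo: "group (homeo S)"
proof (rule groupI)
  fix f g h
  assume "f \<in> carrier (homeo S)" "g \<in> carrier (homeo S)" "h \<in> carrier (homeo S)"
  then obtain f' g' where f: "f \<in> extensional S" "homeomorphism S S f f'"
    and g: "g \<in> extensional S" "homeomorphism S S g g'" by (auto simp: homeo_def)
  have "homeomorphism S S (g \<circ> f) (f' \<circ> g')" using f g by (blast intro: homeomorphism_compose)
  then have "homeomorphism S S (compose S g f) (f' \<circ> g')"
    by (rule homeomorphism_cong) (auto simp: compose_def)
  then show "f \<otimes>\<^bsub>homeo S\<^esub> g \<in> carrier (homeo S)"
    by (auto simp: homeo_def)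
  have "f \<in> S \<rightarrow> S" using f by (auto simp: homeomorphism_def)
  then show "f \<otimes>\<^bsub>homeo S\<^esub> g \<otimes>\<^bsub>homeo S\<^esub> h = f \<otimes>\<^bsub>homeo S\<^esub> (g \<otimes>\<^bsub>homeo S\<^esub> h)"
    by (simp add: homeo_def compose_assoc)
next
  have "homeomorphism S S (\<lambda>x\<in>S. x) (\<lambda>x. x)"
    by (rule homeomorphism_cong[OF homeomorphism_ident]) auto
  then show "\<one>\<^bsub>homeo S\<^esub> \<in> carrier (homeo S)" by (auto simp: homeo_def)
next
  fix f assume "f \<in> carrier (homeo S)"
  then obtain g where f: "f \<in> extensional S" "homeomorphism S S f g" by (auto simp: homeo_def)
  show "\<one>\<^bsub>homeo S\<^esub> \<otimes>\<^bsub>homeo S\<^esub> f = f"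
    using f by (auto simp: homeo_def compose_def extensional_def fun_eq_iff)
  have "homeomorphism S S g f" using f homeomorphism_symD by blast
  then have "homeomorphism S S (restrict g S) f"
    by (rule homeomorphism_cong) auto
  then have "restrict g S \<in> carrier (homeo S)" by (auto simp: homeo_def)
  moreover have "restrict g S \<otimes>\<^bsub>homeo S\<^esub> f = \<one>\<^bsub>homeo S\<^esub>"
    using f by (auto simp: homeo_def compose_def homeomorphism_def fun_eq_iff)
  ultimately show "\<exists>h\<in>carrier (homeo S). h \<otimes>\<^bsub>homeo S\<^esub> f = \<one>\<^bsub>homeo S\<^esub>" by blast
qed

lemma subgroup_homeo_plus: "subgroup (carrier (homeo_plus S)) (homeo S)"
proof -
  interpret group "homeo S" by (rule group_homeo)
  have maps: "f x \<in> S" if "f \<in> carrier (homeo S)" "x \<in> S" for f x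
    using that by (auto simp: homeo_def homeomorphism_def)
  show ?thesis
  proof
    show "carrier (homeo_plus S) \<subseteq> carrier (homeo S)" by (auto simp: homeo_plus_def)
  next
    fix f g assume fg: "f \<in> carrier (homeo_plus S)" "g \<in> carrier (homeo_plus S)"
    then have "strict_mono_on S (compose S g f)"
      by (auto simp: homeo_plus_def strict_mono_on_def compose_def maps)
    then show "f \<otimes>\<^bsub>homeo S\<^esub> g \<in> carrier (homeo_plus S)"
      using fg m_closed[of f g] by (auto simp: homeo_plus_def) (simp add: homeo_def)
  next
    show "\<one>\<^bsub>homeo S\<^esub> \<in> carrier (homeo_plus S)"
      using one_closed by (auto simp: homeo_plus_def) (auto simp: homeo_def strict_mono_on_def)
  next
    fix f assume f: "f \<in> carrier (homeo_plus S)"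
    then have fc: "f \<in> carrier (homeo S)" and fm: "strict_mono_on S f"
      by (auto simp: homeo_plus_def)
    let ?g = "inv\<^bsub>homeo S\<^esub> f"
    have gc: "?g \<in> carrier (homeo S)" using fc by simp
    have "?g \<otimes>\<^bsub>homeo S\<^esub> f = \<one>\<^bsub>homeo S\<^esub>" using fc by simp
    then have id: "f (?g x) = x" if "x \<in> S" for x
      using that by (auto simp: homeo_def compose_def fun_eq_iff restrict_def split: if_splits)
    have "strict_mono_on S ?g"
    proof (rule strict_mono_onI)
      fix x y assume xy: "x \<in> S" "y \<in> S" "x < y"
      show "?g x < ?g y"
      proof (rule ccontr)
        assume "\<not> ?g x < ?g y"
        then have "f (?g y) \<le> f (?g x)"
          using fm maps[OF gc] xy by (metis not_less strict_mono_on_leD)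
        then show False using id xy by simp
      qed
    qed
    then show "?g \<in> carrier (homeo_plus S)" using gc by (simp add: homeo_plus_def)
  qed
qed

lemma group_homeo_plus: "group (homeo_plus S)"
proof -
  have "homeo_plus S = (homeo S)\<lparr>carrier := carrier (homeo_plus S)\<rparr>"
    by (simp add: homeo_plus_def)
  then show ?thesis
    using subgroup.subgroup_is_group[OF subgroup_homeo_plus group_homeo] by metis
qed


section \<open>Thompson's group and the maps on the unit interval\<close>

abbreviation unit_interval :: "real set" ("\<I>") where "\<I> \<equiv> {0..1}"

definition dyadic :: "real set" where
  "dyadic = {of_int m / 2 ^ k | (m::int) (k::nat). True}"

definition piecewise_linear :: "(real \<Rightarrow> real) \<Rightarrow> bool" where
  "piecewise_linear f \<longleftrightarrow>
     (\<exists>B. finite B \<and>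
        (\<forall>a\<in>\<I>. \<forall>b\<in>\<I>. a < b \<and> {a<..<b} \<inter> B = {} \<longrightarrow>
           (\<exists>m c. \<forall>t\<in>{a..b}. f t = m * t + c)))"

text \<open>At the two endpoints of the interval, derivatives are one-sided.\<close>

definition thompson_F :: "(real \<Rightarrow> real) set" where
  "thompson_F = {f \<in> carrier (homeo_plus \<I>).
     piecewise_linear f \<and>
     (\<exists>D. finite D \<and> D \<subseteq> dyadic \<and> (\<forall>x\<in>\<I> - D. f differentiable (at x within \<I>))) \<and>
     (\<forall>x\<in>\<I>. \<forall>d. (f has_real_derivative d) (at x within \<I>) \<longrightarrow> (\<exists>k::int. d = 2 powi k))}"

definition thompson_F_on :: "real \<Rightarrow> real \<Rightarrow> (real \<Rightarrow> real) set" where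
  "thompson_F_on r s = {f \<in> thompson_F. supp \<I> f \<subseteq> {r..s}}"

definition iota0 :: "real \<Rightarrow> real" where
  "iota0 = (\<lambda>t\<in>\<I>. 1 - t)"

definition flip :: "(real \<Rightarrow> real) \<Rightarrow> real \<Rightarrow> real" where
  "flip f = iota0 \<otimes>\<^bsub>homeo \<I>\<^esub> f \<otimes>\<^bsub>homeo \<I>\<^esub> iota0"

definition nu1 :: "(real \<Rightarrow> real) \<Rightarrow> real \<Rightarrow> real" where
  "nu1 c0 = c0 \<otimes>\<^bsub>homeo \<I>\<^esub> flip c0"

lemma flip_apply:
  assumes "f \<in> carrier (homeo \<I>)" "t \<in> \<I>" shows "flip f t = 1 - f (1 - t)"
proof -
  have "f (1 - t) \<in> \<I>" using assms unfolding homeo_def homeomorphism_def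
    by (auto dest!: equalityD1 simp: image_subset_iff)
  then show ?thesis using assms(2) by (simp add: flip_def homeo_def compose_def iota0_def)
qed

lemma iota0_carrier: "iota0 \<in> carrier (homeo \<I>)"
proof -
  have "homeomorphism \<I> \<I> (\<lambda>t. 1 - t) (\<lambda>t::real. 1 - t)"
    unfolding homeomorphism_def
    by (auto intro!: continuous_intros image_eqI[where x = "1 - _"])
  then have "homeomorphism \<I> \<I> iota0 (\<lambda>t. 1 - t)"
    by (rule homeomorphism_cong) (auto simp: iota0_def)
  then show ?thesis by (auto simp: homeo_def iota0_def)
qed

lemma flip_homeo_plus:
  assumes "f \<in> carrier (homeo_plus \<I>)" shows "flip f \<in> carrier (homeo_plus \<I>)"
proof -
  interpret group "homeo \<I>" by (rule group_homeo)
  have f: "f \<in> carrier (homeo \<I>)" and m: "strict_mono_on \<I> f"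
    using assms by (auto simp: homeo_plus_def)
  have "flip f \<in> carrier (homeo \<I>)" using f iota0_carrier by (simp add: flip_def)
  moreover have "strict_mono_on \<I> (flip f)"
    using m by (auto intro!: strict_mono_onI simp: flip_apply[OF f] strict_mono_onD)
  ultimately show ?thesis by (simp add: homeo_plus_def)
qed

lemma nu1_homeo_plus:
  assumes "c0 \<in> carrier (homeo_plus \<I>)" shows "nu1 c0 \<in> carrier (homeo_plus \<I>)"
  unfolding nu1_def using subgroup.m_closed[OF subgroup_homeo_plus assms flip_homeo_plus[OF assms]] .


section \<open>Quasi-periodic labellings\<close>

definition half_integers :: "real set" where
  "half_integers = {x. 2 * x \<in> \<int>}"

datatype ab = gen_a | gen_b

text \<open>Only the values of a labelling on the half integers matter.\<close>

definition labelling :: "(real \<Rightarrow> ab letter) \<Rightarrow> bool" where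
  "labelling \<rho> \<longleftrightarrow>
     (\<forall>k\<in>\<int>. \<rho> k \<in> {Pos gen_a, Neg gen_a}) \<and>
     (\<forall>k\<in>half_integers - \<int>. \<rho> k \<in> {Pos gen_b, Neg gen_b})"

definition blocks :: "real set set" where
  "blocks = {{k + real i / 2 | i. i \<le> n} | k n. k \<in> half_integers}"

definition block_word :: "(real \<Rightarrow> ab letter) \<Rightarrow> real set \<Rightarrow> ab letter list" where
  "block_word \<rho> X = map \<rho> (sorted_list_of_set X)"

definition quasi_periodic :: "(real \<Rightarrow> ab letter) \<Rightarrow> bool" where
  "quasi_periodic \<rho> \<longleftrightarrow>
     (\<forall>X\<in>blocks. \<exists>n. \<forall>Y\<in>blocks. card Y \<ge> n \<longrightarrow> sublist (block_word \<rho> X) (block_word \<rho> Y)) \<and>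
     (\<forall>X\<in>blocks. \<exists>Y\<in>blocks. block_word \<rho> Y = inv_word (block_word \<rho> X))"

lemma block_word_eq:
  "block_word \<rho> {k + real i / 2 | i. i \<le> n} = map (\<lambda>i. \<rho> (k + real i / 2)) [0..<Suc n]"
proof -
  let ?xs = "map (\<lambda>i. k + real i / 2) [0..<Suc n]"
  have "sorted_wrt (<) ?xs"
    by (auto simp: sorted_wrt_map sorted_wrt_iff_nth_less simp del: upt_Suc)
  moreover have "set ?xs = {k + real i / 2 | i. i \<le> n}"
    by (auto simp: image_iff less_Suc_eq_le simp del: upt_Suc)
  ultimately have "sorted_list_of_set {k + real i / 2 | i. i \<le> n} = ?xs"
    by (metis sorted_list_of_set.idem_if_sorted_distinct strict_sorted_iff)
  then show ?thesis by (simp add: block_word_def comp_def del: upt_Suc)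
qed


section \<open>The groups \<open>G\<^sub>\<rho>\<close>\<close>

text \<open>The point \<open>x\<close> is written as \<open>n + t\<close>, respectively \<open>n - 1/2 + t\<close>, with \<open>n\<close> an integer
  and \<open>0 \<le> t < 1\<close>; see \<open>zeta_apply\<close> and \<open>chi_apply\<close> below for \<open>t = 1\<close>.\<close>

definition zeta :: "(real \<Rightarrow> ab letter) \<Rightarrow> (real \<Rightarrow> real) \<Rightarrow> real \<Rightarrow> real" where
  "zeta \<rho> \<nu> x = (let n = of_int \<lfloor>x\<rfloor>; t = x - n in
     if \<rho> (n + 1/2) = Pos gen_b then n + \<nu> t else n + flip \<nu> t)"

definition chi :: "(real \<Rightarrow> ab letter) \<Rightarrow> (real \<Rightarrow> real) \<Rightarrow> real \<Rightarrow> real" where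
  "chi \<rho> \<nu> x = (let n = of_int \<lfloor>x + 1/2\<rfloor>; t = x - (n - 1/2) in
     if \<rho> n = Pos gen_a then n - 1/2 + \<nu> t else n - 1/2 + flip \<nu> t)"

definition G_rho ::
  "(real \<Rightarrow> ab letter) \<Rightarrow> (real \<Rightarrow> real) \<Rightarrow> (real \<Rightarrow> real) \<Rightarrow> (real \<Rightarrow> real) \<Rightarrow> (real \<Rightarrow> real) monoid"
  where
  "G_rho \<rho> \<nu>\<^sub>1 \<nu>\<^sub>2 \<nu>\<^sub>3 = subgroup_generated (homeo_plus UNIV)
     {zeta \<rho> \<nu>\<^sub>1, zeta \<rho> \<nu>\<^sub>2, zeta \<rho> \<nu>\<^sub>3, chi \<rho> \<nu>\<^sub>1, chi \<rho> \<nu>\<^sub>2, chi \<rho> \<nu>\<^sub>3}"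

lemma homeo_plus_endpoints:
  assumes "f \<in> carrier (homeo_plus \<I>)" shows "f 0 = 0" "f 1 = 1"
proof -
  have im: "f ` \<I> = \<I>" and m: "strict_mono_on \<I> f"
    using assms by (auto simp: homeo_plus_def homeo_def homeomorphism_def)
  have le: "f s \<le> f t" if "s \<in> \<I>" "t \<in> \<I>" "s \<le> t" for s t
    using m that by (simp add: strict_mono_on_leD)
  have mem: "f 0 \<in> \<I>" "f 1 \<in> \<I>" using im by auto
  have "0 \<in> f ` \<I>" "1 \<in> f ` \<I>" using im by auto
  then obtain s t where "s \<in> \<I>" "f s = 0" "t \<in> \<I>" "f t = 1" by auto
  with le[of 0 s] le[of t 1] mem show "f 0 = 0" "f 1 = 1" by auto
qed

lemma zeta_apply:
  fixes n :: int and t :: real and \<nu> :: "real \<Rightarrow> real"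
  assumes "\<nu> \<in> carrier (homeo_plus \<I>)" "t \<in> \<I>"
  shows "zeta \<rho> \<nu> (n + t) =
    (if \<rho> (n + 1/2) = Pos gen_b then n + \<nu> t else n + flip \<nu> t)"
proof (cases "t = 1")
  case True
  note e = homeo_plus_endpoints[OF assms(1)] homeo_plus_endpoints[OF flip_homeo_plus[OF assms(1)]]
  have "\<lfloor>of_int n + t\<rfloor> = n + 1" using True by simp
  then show ?thesis using True e by (simp add: zeta_def Let_def)
next
  case False
  then have "\<lfloor>of_int n + t\<rfloor> = n" using assms(2) by (intro floor_unique) auto
  then show ?thesis by (simp add: zeta_def Let_def)
qed

lemma chi_apply:
  fixes n :: int and t :: real and \<nu> :: "real \<Rightarrow> real"
  assumes "\<nu> \<in> carrier (homeo_plus \<I>)" "t \<in> \<I>"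
  shows "chi \<rho> \<nu> (n - 1/2 + t) =
    (if \<rho> n = Pos gen_a then n - 1/2 + \<nu> t else n - 1/2 + flip \<nu> t)"
proof (cases "t = 1")
  case True
  note e = homeo_plus_endpoints[OF assms(1)] homeo_plus_endpoints[OF flip_homeo_plus[OF assms(1)]]
  have "\<lfloor>of_int n - 1/2 + t + 1/2\<rfloor> = n + 1" using True by simp
  then show ?thesis using True e by (simp add: chi_def Let_def)
next
  case False
  then have "\<lfloor>of_int n - 1/2 + t + 1/2\<rfloor> = n" using assms(2) by (intro floor_unique) auto
  then show ?thesis by (simp add: chi_def Let_def)
qed

lemma tiled_homeo_plus:
  fixes g :: "int \<Rightarrow> real \<Rightarrow> real" and c :: real
  assumes g: "\<And>n. g n \<in> carrier (homeo_plus \<I>)"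
    and f: "\<And>n t. t \<in> \<I> \<Longrightarrow> f (of_int n + c + t) = of_int n + c + g n t"
  shows "f \<in> carrier (homeo_plus UNIV)"
proof -
  have im: "g n ` \<I> = \<I>" and m: "strict_mono_on \<I> (g n)" for n
    using g[of n] by (auto simp: homeo_plus_def homeo_def homeomorphism_def)
  have dec: "\<exists>n t. x = of_int n + c + t \<and> 0 \<le> t \<and> t < 1" for x
    by (rule exI[of _ "\<lfloor>x - c\<rfloor>"], rule exI[of _ "x - c - of_int \<lfloor>x - c\<rfloor>"])
       (simp, linarith)
  have mem: "0 \<le> g n t" "g n t \<le> 1" if "0 \<le> t" "t \<le> 1" for n t
    using im[of n] that by (auto simp: set_eq_iff image_iff) (metis atLeastAtMost_iff)+
  have lt1: "g n t < 1" if "0 \<le> t" "t < 1" for n t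
    using strict_mono_onD[OF m[of n], of t 1] that homeo_plus_endpoints(2)[OF g[of n]] by auto
  have sm: "strict_mono f"
  proof (rule strict_monoI)
    fix x y :: real assume xy: "x < y"
    obtain n t where x: "x = of_int n + c + t" "0 \<le> t" "t < 1" using dec by blast
    obtain k s where y: "y = of_int k + c + s" "0 \<le> s" "s < 1" using dec by blast
    have fx: "f x = of_int n + c + g n t" and fy: "f y = of_int k + c + g k s"
      using f x y by auto
    have "n \<le> k"
    proof (rule ccontr)
      assume "\<not> n \<le> k"
      then have "real_of_int k + 1 \<le> of_int n" by linarith
      then show False using xy x y by linarith
    qed
    then consider "n = k" | "real_of_int n + 1 \<le> of_int k" by linarith
    then show "f x < f y"
    proof cases
      case 1
      then have "t < s" using xy x y by simp
      then show ?thesis using strict_mono_onD[OF m[of k], of t s] x y fx fy 1 by auto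
    next
      case 2
      then show ?thesis using fx fy lt1[of t n] mem(1)[of s k] x y by linarith
    qed
  qed
  have "\<exists>x. y = f x" for y
  proof -
    obtain n t where y: "y = of_int n + c + t" "0 \<le> t" "t < 1" using dec by blast
    then have "t \<in> g n ` \<I>" using im by auto
    then obtain s where "s \<in> \<I>" "t = g n s" by auto
    then show ?thesis using f y by metis
  qed
  then have surj: "surj f" by (simp add: surj_def)
  have inj: "inj f" using sm by (simp add: strict_mono_imp_inj_on)
  have sm': "strict_mono (inv_into UNIV f)"
    using strict_mono_inv[OF sm surj, of "inv_into UNIV f"] inj by simp
  have c1: "continuous_on UNIV f"
    using sm surj by (intro continuous_onI_mono) (auto simp: strict_mono_less_eq)
  have c2: "continuous_on UNIV (inv_into UNIV f)"
    using sm' inj by (intro continuous_onI_mono) (auto simp: strict_mono_less_eq inj_imp_surj_inv)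
  have "homeomorphism UNIV UNIV f (inv_into UNIV f)"
    unfolding homeomorphism_def using c1 c2 surj inj
    by (auto simp: surj_f_inv_f inj_imp_surj_inv)
  then show ?thesis using sm by (auto simp: homeo_plus_def homeo_def)
qed

lemma zeta_homeo_plus:
  assumes "\<nu> \<in> carrier (homeo_plus \<I>)" shows "zeta \<rho> \<nu> \<in> carrier (homeo_plus UNIV)"
proof (rule tiled_homeo_plus[where c = 0 and
      g = "\<lambda>n. if \<rho> (of_int n + 1/2) = Pos gen_b then \<nu> else flip \<nu>"])
  show "(if \<rho> (of_int n + 1/2) = Pos gen_b then \<nu> else flip \<nu>) \<in> carrier (homeo_plus \<I>)" for n
    using assms flip_homeo_plus by auto
qed (use zeta_apply[OF assms] in auto)

lemma chi_homeo_plus: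
  assumes "\<nu> \<in> carrier (homeo_plus \<I>)" shows "chi \<rho> \<nu> \<in> carrier (homeo_plus UNIV)"
proof (rule tiled_homeo_plus[where c = "-1/2" and
      g = "\<lambda>n. if \<rho> (of_int n) = Pos gen_a then \<nu> else flip \<nu>"])
  show "(if \<rho> (of_int n) = Pos gen_a then \<nu> else flip \<nu>) \<in> carrier (homeo_plus \<I>)" for n
    using assms flip_homeo_plus by auto
qed (use chi_apply[OF assms] in auto)

end

theory Submission
  imports Defs
begin

text \<open>A presentation of \<open>G\<^sub>\<rho>\<close> involves only finitely many relators, and whether a word in the
  generators acts trivially depends only on the subwords of \<open>\<rho>\<close> of a bounded length. If \<open>\<rho>'\<close>
  repeats a long stretch of \<open>\<rho>\<close> periodically, all its subwords up to this length occur in \<open>\<rho>\<close>,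
  so every relation of a finitely presented \<open>G\<^sub>\<rho>\<close> would also hold in the group of \<open>\<rho>'\<close>. But
  \<open>\<rho>'\<close> has some longer subword that does not occur in \<open>\<rho>\<close>, and there is a group word that acts
  nontrivially exactly for the labellings in which this subword or its inverse occurs. It is built
  letter by letter: from an element supported in the cells (the half-unit intervals between
  neighbouring letters) just before the last letter \<open>z\<close> of a pattern, conjugation with an element
  that carries these cells across \<open>z\<close>, followed by taking the commutator with an element
  supported in the cells just before the letters \<open>z'\<close>, yields an element for the pattern
  extended by \<open>z'\<close>. Inverse patterns take care of themselves by reflection.\<close>

section \<open>Words in the generators of a group\<close>

lemma gen_of_inv_word [simp]: "gen_of ` set (inv_word w) = gen_of ` set w"
  by (simp add: inv_word_def image_image)

fun letter_value :: "('a, 'b) monoid_scheme \<Rightarrow> ('i \<Rightarrow> 'a) \<Rightarrow> 'i letter \<Rightarrow> 'a" where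
  "letter_value G g (Pos i) = g i"
| "letter_value G g (Neg i) = inv\<^bsub>G\<^esub> g i"

text \<open>Evaluation applies to arbitrary letter lists, reduced or not, so words can be
  concatenated and substituted without normalising. In \<open>homeo_plus UNIV\<close> the first
  letter acts first.\<close>

fun word_value :: "('a, 'b) monoid_scheme \<Rightarrow> ('i \<Rightarrow> 'a) \<Rightarrow> 'i letter list \<Rightarrow> 'a" where
  "word_value G g [] = \<one>\<^bsub>G\<^esub>"
| "word_value G g (l # w) = letter_value G g l \<otimes>\<^bsub>G\<^esub> word_value G g w"

fun letter_subst :: "('i \<Rightarrow> 'j letter list) \<Rightarrow> 'i letter \<Rightarrow> 'j letter list" where
  "letter_subst V (Pos i) = V i"
| "letter_subst V (Neg i) = inv_word (V i)"

definition word_subst :: "('i \<Rightarrow> 'j letter list) \<Rightarrow> 'i letter list \<Rightarrow> 'j letter list" where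
  "word_subst V w = concat (map (letter_subst V) w)"

lemma gen_of_word_subst:
  assumes "\<And>i. i \<in> I \<Longrightarrow> gen_of ` set (V i) \<subseteq> J" and "gen_of ` set w \<subseteq> I"
  shows "gen_of ` set (word_subst V w) \<subseteq> J"
  using assms(2)
proof (induction w)
  case (Cons l w)
  then have "gen_of ` set (letter_subst V l) \<subseteq> J" using assms(1) by (cases l) simp_all
  then show ?case using Cons by (simp add: word_subst_def image_Un)
qed (simp add: word_subst_def)

context group
begin

lemma letter_value_closed:
  "g \<in> I \<rightarrow> carrier G \<Longrightarrow> gen_of l \<in> I \<Longrightarrow> letter_value G g l \<in> carrier G"
  by (cases l) auto

lemma word_value_closed:
  assumes "g \<in> I \<rightarrow> carrier G" "gen_of ` set w \<subseteq> I" shows "word_value G g w \<in> carrier G"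
  using assms(2) by (induction w) (auto intro: letter_value_closed[OF assms(1)])

lemma word_value_append:
  assumes "g \<in> I \<rightarrow> carrier G" "gen_of ` set u \<subseteq> I" "gen_of ` set v \<subseteq> I"
  shows "word_value G g (u @ v) = word_value G g u \<otimes> word_value G g v"
  using assms(2)
  by (induction u)
     (auto simp: m_assoc letter_value_closed[OF assms(1)] word_value_closed[OF assms(1)] assms(3))

lemma letter_value_inv:
  "g \<in> I \<rightarrow> carrier G \<Longrightarrow> gen_of l \<in> I \<Longrightarrow> letter_value G g (inv_letter l) = inv (letter_value G g l)"
  by (cases l) (auto simp: Pi_iff)

lemma word_value_inv_word:
  assumes "g \<in> I \<rightarrow> carrier G" "gen_of ` set w \<subseteq> I"
  shows "word_value G g (inv_word w) = inv (word_value G g w)"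
  using assms(2)
proof (induction w)
  case (Cons l w)
  have "word_value G g (inv_word (l # w)) = word_value G g (inv_word w @ [inv_letter l])"
    by (simp add: inv_word_def)
  also have "\<dots> = word_value G g (inv_word w) \<otimes> word_value G g [inv_letter l]"
    by (rule word_value_append[OF assms(1)]) (use Cons in auto)
  finally show ?case using Cons
    by (simp add: letter_value_inv[OF assms(1)] letter_value_closed[OF assms(1)]
        word_value_closed[OF assms(1)] inv_mult_group)
qed (simp add: inv_word_def)

lemma word_value_push_letter:
  assumes "g \<in> I \<rightarrow> carrier G" "gen_of l \<in> I" "gen_of ` set w \<subseteq> I"
  shows "word_value G g (push_letter l w) = letter_value G g l \<otimes> word_value G g w"
proof (cases w)
  case (Cons m v)
  have c: "letter_value G g l \<in> carrier G" "word_value G g v \<in> carrier G"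
    using assms Cons by (auto intro: letter_value_closed word_value_closed)
  show ?thesis
  proof (cases "m = inv_letter l")
    case True
    then show ?thesis using c Cons
      by (simp add: letter_value_inv[OF assms(1,2)] flip: m_assoc)
  qed (simp add: Cons)
qed simp

text \<open>Cancelling a letter against its inverse leaves a product unchanged; this lets evaluation
  descend to the free group.\<close>

lemma word_value_reduce_word:
  assumes "g \<in> I \<rightarrow> carrier G" "gen_of ` set w \<subseteq> I"
  shows "word_value G g (reduce_word w) = word_value G g w"
  using assms(2)
proof (induction w)
  case (Cons l w)
  then have "gen_of ` set (reduce_word w) \<subseteq> I" using set_reduce_word[of w] by auto
  then show ?case using Cons word_value_push_letter[OF assms(1), of l "reduce_word w"]
    by (simp add: reduce_word_def)
qed (simp add: reduce_word_def)

lemma letter_value_subst: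
  assumes "g \<in> J \<rightarrow> carrier G" "\<And>i. i \<in> I \<Longrightarrow> gen_of ` set (V i) \<subseteq> J" "gen_of l \<in> I"
  shows "word_value G g (letter_subst V l) = letter_value G (\<lambda>i. word_value G g (V i)) l"
  using assms by (cases l) (auto simp: word_value_inv_word)

lemma word_value_subst:
  assumes "g \<in> J \<rightarrow> carrier G" "\<And>i. i \<in> I \<Longrightarrow> gen_of ` set (V i) \<subseteq> J" "gen_of ` set w \<subseteq> I"
  shows "word_value G g (word_subst V w) = word_value G (\<lambda>i. word_value G g (V i)) w"
  using assms(3)
proof (induction w)
  case (Cons l w)
  have "gen_of ` set (letter_subst V l) \<subseteq> J"
    using gen_of_word_subst[of I V J "[l]"] assms(2) Cons.prems by (simp add: word_subst_def)
  moreover have "gen_of ` set (word_subst V w) \<subseteq> J"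
    using gen_of_word_subst[of I V J w] assms(2) Cons.prems by simp
  ultimately have "word_value G g (letter_subst V l @ word_subst V w)
      = word_value G g (letter_subst V l) \<otimes> word_value G g (word_subst V w)"
    by (rule word_value_append[OF assms(1)])
  then show ?case using Cons letter_value_subst[OF assms(1), of I V l] assms(2) by (simp add: word_subst_def)
qed (simp add: word_subst_def)

lemma word_value_cong:
  "(\<And>i. i \<in> I \<Longrightarrow> g i = h i) \<Longrightarrow> gen_of ` set w \<subseteq> I \<Longrightarrow> word_value G g w = word_value G h w"
proof (induction w)
  case (Cons l w)
  then show ?case by (cases l) auto
qed simp

lemma word_value_hom:
  assumes "group H" "\<phi> \<in> hom G H" "g \<in> I \<rightarrow> carrier G" "gen_of ` set w \<subseteq> I"
  shows "\<phi> (word_value G g w) = word_value H (\<lambda>i. \<phi> (g i)) w"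
proof -
  note closed = letter_value_closed[OF assms(3)] word_value_closed[OF assms(3)]
  interpret group_hom G H \<phi>
    using assms by (simp add: group_hom_def group_hom_axioms_def is_group)
  show ?thesis using assms(4)
  proof (induction w)
    case (Cons l w)
    have "\<phi> (letter_value G g l) = letter_value H (\<lambda>i. \<phi> (g i)) l"
      using Cons.prems assms(3) by (cases l) (auto simp: Pi_iff)
    then show ?case
      using Cons closed by auto
  qed simp
qed

lemma generate_word_value:
  assumes g: "g \<in> I \<rightarrow> carrier G" and "x \<in> generate G (g ` I)"
  shows "\<exists>w. gen_of ` set w \<subseteq> I \<and> word_value G g w = x"
  using assms(2)
proof induction
  case one
  show ?case by (rule exI[of _ "[]"]) simp
next
  case (incl x)
  then obtain i where "i \<in> I" "x = g i" by auto
  then show ?case using g by (intro exI[of _ "[Pos i]"]) (auto simp: Pi_iff)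
next
  case (inv x)
  then obtain i where "i \<in> I" "x = g i" by auto
  then show ?case using g by (intro exI[of _ "[Neg i]"]) (auto simp: Pi_iff)
next
  case (eng x y)
  then obtain u v where "gen_of ` set u \<subseteq> I" "word_value G g u = x"
    "gen_of ` set v \<subseteq> I" "word_value G g v = y" by auto
  then show ?case using word_value_append[OF g, of u v]
    by (intro exI[of _ "u @ v"]) auto
qed

section \<open>Homomorphisms out of free and presented groups\<close>

lemma normal_closure_kernel:
  assumes H: "group H" and \<phi>: "\<phi> \<in> hom G H" and R: "R \<subseteq> carrier G"
    and "\<And>r. r \<in> R \<Longrightarrow> \<phi> r = \<one>\<^bsub>H\<^esub>" and "x \<in> normal_closure G R"
  shows "\<phi> x = \<one>\<^bsub>H\<^esub>"
proof -
  note incl = generate_subgroup_incl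
  interpret group_hom G H \<phi>
    using assms by (simp add: group_hom_def group_hom_axioms_def is_group)
  have "normal_closure G R \<subseteq> kernel G H \<phi>"
    unfolding normal_closure_def
    by (rule incl[OF _ subgroup_kernel])
       (use assms in \<open>auto simp: kernel_def subset_iff\<close>)
  then show ?thesis using assms(5) by (auto simp: kernel_def)
qed

end

text \<open>Suffixes of a reduced word are reduced, so prepending its letters one at a time never
  causes a cancellation.\<close>

lemma word_value_free_group:
  "w \<in> carrier (free_group S) \<Longrightarrow> word_value (free_group S) (\<lambda>i. [Pos i]) w = w"
proof (induction w)
  case (Cons l w)
  interpret F: group "free_group S" by (rule group_free_group)
  have "w \<in> carrier (free_group S)" using Cons.prems reduced_ConsD by (auto simp: free_group_def)
  then have IH: "word_value (free_group S) (\<lambda>i. [Pos i]) w = w" using Cons.IH by blast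
  have l: "gen_of l \<in> S" using Cons.prems by (auto simp: free_group_def)
  have "letter_value (free_group S) (\<lambda>i. [Pos i]) l = [l]"
  proof (cases l)
    case (Neg i)
    have "inv\<^bsub>free_group S\<^esub> [Pos i] = [Neg i]"
      by (rule F.inv_equality) (use l Neg in \<open>auto simp: free_group_def reduce_word_def\<close>)
    then show ?thesis using Neg by simp
  qed simp
  then show ?case using Cons.prems IH
    by (simp add: free_group_def reduce_word_reduced)
qed (simp add: free_group_def)

lemma word_value_free_group_hom:
  assumes "group H" "x \<in> S \<rightarrow> carrier H"
  shows "word_value H x \<in> hom (free_group S) H"
proof (rule homI)
  interpret group H by fact
  fix u v assume u: "u \<in> carrier (free_group S)" and v: "v \<in> carrier (free_group S)"
  show "word_value H x u \<in> carrier H"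
    using word_value_closed[OF assms(2)] u by (simp add: free_group_def)
  show "word_value H x (u \<otimes>\<^bsub>free_group S\<^esub> v) = word_value H x u \<otimes>\<^bsub>H\<^esub> word_value H x v"
    using u v word_value_reduce_word[OF assms(2), of "u @ v"] word_value_append[OF assms(2), of u v]
    by (simp add: free_group_def image_Un)
qed

text \<open>\<open>Q\<close> consists of the given relators rewritten in the family \<open>g\<close>, together with the
  rewriting of the family in terms of itself.\<close>

lemma finitely_presentable_relators:
  fixes G :: "('a, 'b) monoid_scheme" and g :: "'i \<Rightarrow> 'a"
  assumes "finitely_presentable G" and G: "group G"
    and I: "finite I" and g: "g \<in> I \<rightarrow> carrier G" and gen: "carrier G = generate G (g ` I)"
  obtains Q where "finite Q" "\<And>q. q \<in> Q \<Longrightarrow> gen_of ` set q \<subseteq> I"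
    "\<And>q. q \<in> Q \<Longrightarrow> word_value G g q = \<one>\<^bsub>G\<^esub>"
    "\<And>(K :: ('c, 'd) monoid_scheme) k w.
       \<lbrakk>group K; k \<in> I \<rightarrow> carrier K; \<And>q. q \<in> Q \<Longrightarrow> word_value K k q = \<one>\<^bsub>K\<^esub>;
        gen_of ` set w \<subseteq> I; word_value G g w = \<one>\<^bsub>G\<^esub>\<rbrakk> \<Longrightarrow> word_value K k w = \<one>\<^bsub>K\<^esub>"
proof -
  interpret G: group G by fact
  obtain n R where R: "finite R" "R \<subseteq> carrier (free_group {..<n::nat})"
    and iso: "G \<cong> (free_group {..<n} Mod normal_closure (free_group {..<n}) R)"
    using assms(1) unfolding finitely_presentable_def by auto
  let ?F = "free_group {..<n}"
  let ?N = "normal_closure ?F R"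
  interpret F: group ?F by (rule group_free_group)
  have N: "?N \<lhd> ?F" using R(2) by (rule F.normal_normal_closure)
  interpret N: normal ?N ?F by (rule N)
  interpret FN: group "?F Mod ?N" by (rule N.factorgroup_is_group)
  obtain \<psi> where \<psi>: "\<psi> \<in> iso (?F Mod ?N) G"
    using G.iso_sym[OF iso] by (auto simp: is_iso_def)
  \<comment> \<open>The quotient map followed by the isomorphism exhibits \<open>G\<close> as an
    image of the free group with kernel \<open>?N\<close>.\<close>
  define \<phi> where "\<phi> u = \<psi> (?N #>\<^bsub>?F\<^esub> u)" for u
  have \<psi>hom: "\<psi> \<in> hom (?F Mod ?N) G" using \<psi> by (simp add: iso_def)
  have \<phi>hom: "\<phi> \<in> hom ?F G"
    using hom_compose[OF N.r_coset_hom_Mod \<psi>hom] by (simp add: comp_def \<phi>_def[abs_def])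
  have \<phi>surj: "\<exists>u\<in>carrier ?F. \<phi> u = y" if "y \<in> carrier G" for y
  proof -
    have "y \<in> \<psi> ` carrier (?F Mod ?N)" using \<psi> that by (auto simp: iso_def bij_betw_def)
    then show ?thesis by (auto simp: FactGroup_def RCOSETS_def \<phi>_def)
  qed
  have \<phi>ker: "u \<in> ?N" if "u \<in> carrier ?F" "\<phi> u = \<one>\<^bsub>G\<^esub>" for u
  proof -
    have c: "?N #>\<^bsub>?F\<^esub> u \<in> carrier (?F Mod ?N)"
      using that(1) by (auto simp: FactGroup_def RCOSETS_def)
    have "\<psi> (?N #>\<^bsub>?F\<^esub> u) = \<psi> \<one>\<^bsub>?F Mod ?N\<^esub>"
      using that(2) hom_one[OF \<psi>hom FN.is_group G] by (simp add: \<phi>_def)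
    moreover have "inj_on \<psi> (carrier (?F Mod ?N))" using \<psi> by (simp add: iso_def bij_betw_def)
    ultimately have "?N #>\<^bsub>?F\<^esub> u = \<one>\<^bsub>?F Mod ?N\<^esub>"
      using inj_onD c FN.one_closed by metis
    then have "?N #>\<^bsub>?F\<^esub> u = ?N" by (simp add: FactGroup_def)
    then show ?thesis using F.coset_join1[OF _ that(1) N.subgroup_axioms] by simp
  qed
  have \<phi>R: "\<phi> r = \<one>\<^bsub>G\<^esub>" if "r \<in> R" for r
  proof -
    have "r \<in> ?N"
      unfolding normal_closure_def
    proof (rule generate.incl)
      have "r \<in> carrier ?F" using that R(2) by auto
      then have "r = \<one>\<^bsub>?F\<^esub> \<otimes>\<^bsub>?F\<^esub> r \<otimes>\<^bsub>?F\<^esub> inv\<^bsub>?F\<^esub> \<one>\<^bsub>?F\<^esub>" by simp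
      then show "r \<in> (\<Union>g\<in>carrier ?F. \<Union>r\<in>R. {g \<otimes>\<^bsub>?F\<^esub> r \<otimes>\<^bsub>?F\<^esub> inv\<^bsub>?F\<^esub> g})"
        using that F.one_closed by blast
    qed
    then have "?N #>\<^bsub>?F\<^esub> r = \<one>\<^bsub>?F Mod ?N\<^esub>"
      using F.coset_join2[OF _ N.subgroup_axioms] that R(2) by (auto simp: FactGroup_def)
    then show ?thesis using hom_one[OF \<psi>hom FN.is_group G] by (simp add: \<phi>_def)
  qed
  \<comment> \<open>These are the images of the free generators. Below, \<open>W\<close> writes
    \<open>x\<close> in the family \<open>g\<close> and \<open>V\<close> writes \<open>g\<close> in
    the family \<open>x\<close>, so words can be translated both ways.\<close>
  define x where "x i = \<phi> [Pos i]" for i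
  have Pos: "[Pos i] \<in> carrier ?F" if "i < n" for i using that by (simp add: free_group_def)
  have x: "x \<in> {..<n} \<rightarrow> carrier G"
    using Pos \<phi>hom by (auto simp: x_def hom_def)
  have \<phi>val: "\<phi> u = word_value G x u" if "u \<in> carrier ?F" for u
    using F.word_value_hom[OF G \<phi>hom, of "\<lambda>i. [Pos i]" "{..<n}" u] that Pos
    by (simp add: word_value_free_group x_def[abs_def]) (simp add: free_group_def)
  have "\<forall>i\<in>{..<n}. \<exists>w. gen_of ` set w \<subseteq> I \<and> word_value G g w = x i"
    using G.generate_word_value[OF g] gen x by auto
  then obtain W where W: "\<And>i. i \<in> {..<n} \<Longrightarrow> gen_of ` set (W i) \<subseteq> I"
    "\<And>i. i \<in> {..<n} \<Longrightarrow> word_value G g (W i) = x i" by metis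
  have "\<forall>j\<in>I. \<exists>u\<in>carrier ?F. \<phi> u = g j" using \<phi>surj g by auto
  then obtain V where V: "\<And>j. j \<in> I \<Longrightarrow> V j \<in> carrier ?F" "\<And>j. j \<in> I \<Longrightarrow> \<phi> (V j) = g j"
    by metis
  have V': "gen_of ` set (V j) \<subseteq> {..<n}" if "j \<in> I" for j
    using V(1)[OF that] by (simp add: free_group_def)
  have R': "gen_of ` set r \<subseteq> {..<n}" if "r \<in> R" for r
    using R(2) that by (auto simp: free_group_def)
  have WV: "gen_of ` set (word_subst W (V j)) \<subseteq> I" if "j \<in> I" for j
    using gen_of_word_subst[OF W(1) V'[OF that]] .
  define Q where "Q = word_subst W ` R \<union> (\<lambda>j. Neg j # word_subst W (V j)) ` I"
  have subW: "word_value G g (word_subst W u) = word_value G x u" if "gen_of ` set u \<subseteq> {..<n}" for u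
    using G.word_value_subst[OF g W(1) that] G.word_value_cong[OF W(2) that] by simp
  show thesis
  proof
    show "finite Q" using R(1) I by (simp add: Q_def)
  next
    fix q assume "q \<in> Q"
    then show "gen_of ` set q \<subseteq> I"
      using gen_of_word_subst[OF W(1) R'] WV by (fastforce simp: Q_def)
  next
    fix q assume "q \<in> Q"
    then consider r where "r \<in> R" "q = word_subst W r"
      | j where "j \<in> I" "q = Neg j # word_subst W (V j)" by (auto simp: Q_def)
    then show "word_value G g q = \<one>\<^bsub>G\<^esub>"
    proof cases
      case 1
      then have "r \<in> carrier ?F" using R(2) by auto
      then show ?thesis using 1 subW[OF R'] \<phi>R[OF 1(1)] \<phi>val[of r] by simp
    next
      case 2
      then have "word_value G g (word_subst W (V j)) = g j"
        using subW V' V \<phi>val by metis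
      then show ?thesis using 2 g by (auto simp: Pi_iff)
    qed
  next
    fix K :: "('c, 'd) monoid_scheme" and k w
    assume K: "group K" and k: "k \<in> I \<rightarrow> carrier K"
      and Qk: "\<And>q. q \<in> Q \<Longrightarrow> word_value K k q = \<one>\<^bsub>K\<^esub>"
      and w: "gen_of ` set w \<subseteq> I" and w1: "word_value G g w = \<one>\<^bsub>G\<^esub>"
    interpret K: group K by fact
    define y where "y i = word_value K k (W i)" for i
    have y: "y \<in> {..<n} \<rightarrow> carrier K"
      using K.word_value_closed[OF k W(1)] by (auto simp: y_def)
    note yhom = word_value_free_group_hom[OF K y]
    have subWK: "word_value K k (word_subst W u) = word_value K y u" if "gen_of ` set u \<subseteq> {..<n}" for u
      using K.word_value_subst[OF k W(1) that] by (simp add: y_def[abs_def])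
    \<comment> \<open>The rewriting relators in \<open>Q\<close> make \<open>k\<close> satisfy the
      same rewriting rule as \<open>g\<close>; the relators coming from \<open>R\<close> do not by
      themselves express \<open>k\<close> through \<open>y\<close>.\<close>
    have yV: "word_value K y (V j) = k j" if "j \<in> I" for j
    proof -
      have "inv\<^bsub>K\<^esub> k j \<otimes>\<^bsub>K\<^esub> word_value K y (V j) = \<one>\<^bsub>K\<^esub>"
        using Qk[of "Neg j # word_subst W (V j)"] that subWK[OF V'] by (auto simp: Q_def)
      moreover have "word_value K y (V j) \<in> carrier K" "k j \<in> carrier K"
        using K.word_value_closed[OF y V'] that k by auto
      ultimately show ?thesis by (metis K.inv_equality K.inv_inv K.inv_closed K.inv_comm)
    qed
    have yR: "word_value K y r = \<one>\<^bsub>K\<^esub>" if "r \<in> R" for r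
      using Qk[of "word_subst W r"] that subWK[OF R'] by (auto simp: Q_def)
    \<comment> \<open>Rewriting \<open>w\<close> through \<open>V\<close> gives an element of the
      free group that \<phi> sends to the value of \<open>w\<close> in \<open>G\<close>. That value
      is trivial, so \<open>u\<close> lies in the normal closure of \<open>R\<close>, which
      evaluation at \<open>y\<close> kills.\<close>
    define u where "u = reduce_word (word_subst V w)"
    have sV: "gen_of ` set (word_subst V w) \<subseteq> {..<n}" by (rule gen_of_word_subst[OF V' w])
    then have u: "u \<in> carrier ?F"
      using set_reduce_word[of "word_subst V w"] reduced_reduce_word[of "word_subst V w"]
      by (auto simp: free_group_def u_def)
    have "\<phi> u = word_value G x (word_subst V w)"
      using \<phi>val[OF u] G.word_value_reduce_word[OF x sV] by (simp add: u_def)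
    also have "\<dots> = word_value G (\<lambda>j. word_value G x (V j)) w" by (rule G.word_value_subst[OF x V' w])
    also have "\<dots> = word_value G g w"
      using V \<phi>val by (intro G.word_value_cong[OF _ w]) auto
    finally have "u \<in> ?N" using w1 \<phi>ker[OF u] by simp
    then have "word_value K y u = \<one>\<^bsub>K\<^esub>"
      using F.normal_closure_kernel[OF K yhom R(2) yR] by blast
    moreover have "word_value K y u = word_value K y (word_subst V w)"
      using K.word_value_reduce_word[OF y sV] by (simp add: u_def)
    moreover have "\<dots> = word_value K (\<lambda>j. word_value K y (V j)) w"
      by (rule K.word_value_subst[OF y V' w])
    moreover have "\<dots> = word_value K k w"
      using yV by (rule K.word_value_cong[OF _ w])
    ultimately show "word_value K k w = \<one>\<^bsub>K\<^esub>" by simp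
  qed
qed

section \<open>Labellings\<close>

text \<open>With integer indices in place of half-integers, questions about which generator stands
  at a position become questions of parity.\<close>

definition lab :: "(real \<Rightarrow> ab letter) \<Rightarrow> int \<Rightarrow> ab letter" where
  "lab \<rho> j = \<rho> (of_int j / 2)"

definition segment :: "(real \<Rightarrow> ab letter) \<Rightarrow> int \<Rightarrow> nat \<Rightarrow> ab letter list" where
  "segment \<rho> m n = map (\<lambda>i. lab \<rho> (m + int i)) [0..<n]"

text \<open>Turning the line around reverses the reading direction; inverting the letters as well
  makes the words of the new labelling the formal inverses of the old ones.\<close>

definition reflect :: "(real \<Rightarrow> ab letter) \<Rightarrow> real \<Rightarrow> ab letter" where
  "reflect \<rho> x = inv_letter (\<rho> (- x))"

text \<open>\<open>v\<close> is read from right to left, starting at position \<open>j\<close>.\<close>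

fun occurs :: "(real \<Rightarrow> ab letter) \<Rightarrow> ab letter list \<Rightarrow> int \<Rightarrow> bool" where
  "occurs \<rho> [] j \<longleftrightarrow> True"
| "occurs \<rho> (z # v) j \<longleftrightarrow> lab \<rho> j = z \<and> occurs \<rho> v (j - 1)"

lemma half_int_in_Ints_iff: "of_int j / 2 \<in> (\<int> :: real set) \<longleftrightarrow> even j"
proof
  assume "of_int j / 2 \<in> (\<int> :: real set)"
  then obtain n where "of_int j / 2 = (of_int n :: real)" by (auto elim: Ints_cases)
  then have "(of_int j :: real) = of_int (2 * n)" by simp
  then have "j = 2 * n" by (simp only: of_int_eq_iff)
  then show "even j" by simp
qed auto

lemma half_int_half_integers: "of_int j / 2 \<in> half_integers"
  by (simp add: half_integers_def)

lemma half_integers_cases: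
  assumes "k \<in> half_integers" obtains m :: int where "k = of_int m / 2"
proof -
  from assms obtain m where "2 * k = of_int m" by (auto simp: half_integers_def elim: Ints_cases)
  then show thesis using that[of m] by simp
qed

lemma gen_of_lab:
  assumes "labelling \<rho>" shows "gen_of (lab \<rho> j) = (if even j then gen_a else gen_b)"
proof (cases "even j")
  case True
  then have "lab \<rho> j \<in> {Pos gen_a, Neg gen_a}"
    using assms half_int_in_Ints_iff[of j] unfolding labelling_def lab_def by blast
  then show ?thesis using True by auto
next
  case False
  then have "lab \<rho> j \<in> {Pos gen_b, Neg gen_b}"
    using assms half_int_in_Ints_iff[of j] half_int_half_integers[of j]
    unfolding labelling_def lab_def by blast
  then show ?thesis using False by auto
qed

lemma labellingI:
  assumes "\<And>j. gen_of (lab \<rho> j) = (if even j then gen_a else gen_b)" shows "labelling \<rho>"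
proof -
  have l: "l \<in> {Pos (gen_of l), Neg (gen_of l)}" for l :: "ab letter" by (cases l) auto
  have "\<rho> k \<in> {Pos gen_a, Neg gen_a}" if "k \<in> \<int>" for k
  proof -
    from that obtain n where "k = of_int n" by (auto elim: Ints_cases)
    then have "gen_of (\<rho> k) = gen_a" using assms[of "2 * n"] by (simp add: lab_def)
    then show ?thesis using l[of "\<rho> k"] by simp
  qed
  moreover have "\<rho> k \<in> {Pos gen_b, Neg gen_b}" if "k \<in> half_integers - \<int>" for k
  proof -
    from that obtain m where m: "k = of_int m / 2" "odd m"
      using half_int_in_Ints_iff by (metis DiffE half_integers_cases)
    have "lab \<rho> m = \<rho> k" by (simp only: lab_def m(1))
    then have "gen_of (\<rho> k) = gen_b" using assms[of m] m(2) by simp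
    then show ?thesis using l[of "\<rho> k"] by simp
  qed
  ultimately show ?thesis by (simp add: labelling_def)
qed

lemma lab_reflect: "lab (reflect \<rho>) j = inv_letter (lab \<rho> (- j))"
  by (simp add: lab_def reflect_def)

lemma labelling_reflect: "labelling \<rho> \<Longrightarrow> labelling (reflect \<rho>)"
  by (rule labellingI) (simp add: lab_reflect gen_of_lab)

lemma inv_letter_neq: "inv_letter l \<noteq> l"
  by (cases l) auto

section \<open>Segments, their inverses and their recurrence\<close>

lemma length_segment [simp]: "length (segment \<rho> m n) = n"
  by (simp add: segment_def)

lemma nth_segment [simp]: "i < n \<Longrightarrow> segment \<rho> m n ! i = lab \<rho> (m + int i)"
  by (simp add: segment_def)

lemma segment_eq_iff: "segment \<rho> m n = segment \<rho>' m' n \<longleftrightarrow>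
    (\<forall>i<n. lab \<rho> (m + int i) = lab \<rho>' (m' + int i))"
  by (auto simp: list_eq_iff_nth_eq)

text \<open>Negation carries the window from \<open>m\<close> to \<open>m + n - 1\<close> onto the
  window of the same length that starts at \<open>1 - m - n\<close>.\<close>

lemma inv_word_segment: "inv_word (segment \<rho> m n) = segment (reflect \<rho>) (1 - m - int n) n"
proof (rule nth_equalityI)
  fix i assume "i < length (inv_word (segment \<rho> m n))"
  then have i: "i < n" by (simp add: inv_word_def)
  then have "inv_word (segment \<rho> m n) ! i = inv_letter (lab \<rho> (m + int (n - Suc i)))"
    by (simp add: inv_word_def rev_nth)
  also have "int (n - Suc i) = int n - 1 - int i" using i by simp
  finally show "inv_word (segment \<rho> m n) ! i = segment (reflect \<rho>) (1 - m - int n) n ! i"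
    using i by (simp add: lab_reflect algebra_simps)
qed (simp add: inv_word_def)

lemma occurs_iff_segment:
  "occurs \<rho> v j \<longleftrightarrow> rev v = segment \<rho> (j + 1 - int (length v)) (length v)"
proof (induction v arbitrary: j)
  case (Cons z v)
  have "segment \<rho> (j + 1 - int (length (z # v))) (length (z # v))
      = segment \<rho> (j - 1 + 1 - int (length v)) (length v) @ [lab \<rho> j]"
    by (simp add: segment_def)
  then show ?case using Cons.IH[of "j - 1"] by auto
qed (simp add: segment_def)

lemma block_segment:
  "block_word \<rho> {of_int m / 2 + real i / 2 | i. i \<le> n} = segment \<rho> m (Suc n)"
  unfolding block_word_eq segment_def lab_def by (simp add: add_divide_distrib del: upt_Suc)

lemma segment_block:
  assumes "0 < n"
  obtains X where "X \<in> blocks" "card X = n" "\<And>\<rho>. block_word \<rho> X = segment \<rho> m n"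
proof
  let ?X = "{of_int m / 2 + real i / 2 | i. i \<le> n - 1}"
  show "?X \<in> blocks" using half_int_half_integers[of m] by (auto simp: blocks_def)
  have "?X = (\<lambda>i. of_int m / 2 + real i / 2) ` {..n - 1}" by auto
  moreover have "inj_on (\<lambda>i. of_int m / 2 + real i / 2) {..n - 1}" by (simp add: inj_on_def)
  ultimately show "card ?X = n" using assms by (simp add: card_image)
  show "block_word \<rho> ?X = segment \<rho> m n" for \<rho> using block_segment[of \<rho> m "n - 1"] assms by simp
qed

lemma sublist_segment:
  assumes "sublist u (segment \<rho> m n)"
  obtains k where "m \<le> k" "k + int (length u) \<le> m + int n" "u = segment \<rho> k (length u)"
proof -
  obtain p s where ps: "segment \<rho> m n = p @ u @ s" using assms by (auto simp: sublist_def)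
  then have len: "n = length p + length u + length s"
    by (metis length_append length_segment add.assoc)
  show thesis
  proof (rule that[of "m + int (length p)"])
    show "u = segment \<rho> (m + int (length p)) (length u)"
    proof (rule nth_equalityI)
      fix i assume i: "i < length u"
      then have "u ! i = segment \<rho> m n ! (length p + i)" using ps by (simp add: nth_append)
      then show "u ! i = segment \<rho> (m + int (length p)) (length u) ! i"
        using i len by (simp add: add.assoc)
    qed simp
  qed (use len in auto)
qed

text \<open>One block size beyond the bound in condition (1) serves for all windows at once, so the
  gaps between returns of a word are uniformly bounded.\<close>

lemma quasi_periodic_recurrent:
  assumes "quasi_periodic \<rho>" "0 < n"
  obtains N where "\<And>k. \<exists>l. k \<le> l \<and> l + int n \<le> k + int N \<and> segment \<rho> l n = segment \<rho> m n"
proof -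
  obtain X where X: "X \<in> blocks" "block_word \<rho> X = segment \<rho> m n"
    using segment_block[OF assms(2)] by metis
  then obtain N where N: "\<And>Y. Y \<in> blocks \<Longrightarrow> card Y \<ge> N \<Longrightarrow> sublist (segment \<rho> m n) (block_word \<rho> Y)"
    using assms(1) unfolding quasi_periodic_def by metis
  show thesis
  \<comment> \<open>Blocks are nonempty, so the window length has to be positive.\<close>
  proof (rule that[of "Suc N"])
    fix k
    obtain Y where "Y \<in> blocks" "card Y = Suc N" "block_word \<rho> Y = segment \<rho> k (Suc N)"
      using segment_block[of "Suc N" k] by auto
    then have "sublist (segment \<rho> m n) (segment \<rho> k (Suc N))" using N[of Y] by simp
    then obtain l where "k \<le> l" "l + int n \<le> k + int (Suc N)" "segment \<rho> m n = segment \<rho> l n"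
      by (rule sublist_segment) simp
    then show "\<exists>l. k \<le> l \<and> l + int n \<le> k + int (Suc N) \<and> segment \<rho> l n = segment \<rho> m n" by metis
  qed
qed

lemma quasi_periodic_inverse:
  assumes "quasi_periodic \<rho>"
  obtains l where "segment \<rho> l n = inv_word (segment \<rho> m n)"
proof (cases "n = 0")
  case False
  then obtain X where "X \<in> blocks" "block_word \<rho> X = segment \<rho> m n"
    using segment_block[of n m] by auto
  then obtain Y where Y: "Y \<in> blocks" "block_word \<rho> Y = inv_word (segment \<rho> m n)"
    using assms unfolding quasi_periodic_def by metis
  then obtain k n' where k: "k \<in> half_integers" "Y = {k + real i / 2 | i. i \<le> n'}"
    by (auto simp: blocks_def)
  then obtain l where l: "k = of_int l / 2" by (auto elim: half_integers_cases)
  have eq: "segment \<rho> l (Suc n') = inv_word (segment \<rho> m n)"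
    using Y k block_segment[of \<rho> l n'] l by simp
  then have "Suc n' = n" by (metis length_segment inv_word_segment)
  then show thesis using eq that by simp
qed (use that in \<open>simp add: segment_def inv_word_def\<close>)

text \<open>Repeating a long enough stretch of \<open>\<rho>\<close> periodically creates no new short words. It does
  create a new long one: otherwise the periodic labelling would contain the inverse of its own
  period, and hence, for parity reasons, a letter equal to its own inverse.\<close>

lemma quasi_periodic_approximation:
  assumes \<rho>: "labelling \<rho>" and qp: "quasi_periodic \<rho>"
  obtains \<rho>' v j where "labelling \<rho>'"
    "\<And>i. \<exists>d. even d \<and> (\<forall>t\<le>N. lab \<rho>' (i + int t) = lab \<rho> (i + int t + d))"
    "v \<noteq> []" "occurs \<rho>' v j" "\<And>i. \<not> occurs \<rho> v i" "\<And>i. \<not> occurs (reflect \<rho>) v i"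
proof -
  obtain N' where "\<And>k. \<exists>l. k \<le> l \<and> l + int (Suc N) \<le> k + int N' \<and> segment \<rho> l (Suc N) = segment \<rho> 0 (Suc N)"
    by (rule quasi_periodic_recurrent[OF qp, of "Suc N" 0]) auto
  \<comment> \<open>Starting the search at 1 rather than 0 yields a proper return \<open>p\<close>
    of the word formed by the first \<open>N + 1\<close> letters.\<close>
  from this[of 1] obtain p where p: "1 \<le> p" "segment \<rho> p (Suc N) = segment \<rho> 0 (Suc N)" by auto
  then have rep: "lab \<rho> (p + int i) = lab \<rho> (int i)" if "i \<le> N" for i
    using that by (simp add: segment_eq_iff less_Suc_eq_le)
  have "even p"
    using gen_of_lab[OF \<rho>, of p] gen_of_lab[OF \<rho>, of 0] rep[of 0] by (auto split: if_splits)
  \<comment> \<open>\<rho>' repeats the letters at positions 0 to \<open>p - 1\<close>. Since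
    \<open>p\<close> is even, it still alternates between the two generators.\<close>
  define \<rho>' where "\<rho>' x = lab \<rho> (\<lfloor>2 * x\<rfloor> mod p)" for x :: real
  have lab': "lab \<rho>' i = lab \<rho> (i mod p)" for i by (simp add: lab_def[of \<rho>'] \<rho>'_def)
  have \<rho>': "labelling \<rho>'"
    using \<open>even p\<close> by (intro labellingI) (simp add: lab' gen_of_lab[OF \<rho>] dvd_mod_iff)
  \<comment> \<open>The periodic letters agree with those of \<rho> for \<open>N\<close> further
    places beyond the first period. As \<open>N\<close> may exceed \<open>p\<close>, several steps
    back by \<open>p\<close> may be needed, hence the strong induction.\<close>
  have agree: "lab \<rho> (int i mod p) = lab \<rho> (int i)" if "int i \<le> p + int N" for i
    using that
  proof (induction i rule: less_induct)
    case (less i)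
    show ?case
    proof (cases "int i < p")
      case False
      define i' where "i' = nat (int i - p)"
      have i': "int i = p + int i'" using False p(1) by (simp add: i'_def)
      then have "i' < i" "i' \<le> N" using p(1) less.prems by linarith+
      then have "lab \<rho> (int i' mod p) = lab \<rho> (int i')" using less by simp
      then show ?thesis using i' rep[OF \<open>i' \<le> N\<close>] by simp
    qed simp
  qed
  \<comment> \<open>Shifting by a multiple of \<open>p\<close> moves the start of the window into
    the first period, and the whole window then lies in the range of \<open>agree\<close>.\<close>
  have window: "\<exists>d. even d \<and> (\<forall>t\<le>N. lab \<rho>' (i + int t) = lab \<rho> (i + int t + d))" for i
  proof (intro exI[of _ "- (p * (i div p))"] conjI allI impI)
    fix t assume "t \<le> N"
    define r where "r = nat (i mod p)"
    have r: "int r = i mod p" "int r < p" using p(1) by (simp_all add: r_def)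
    have "lab \<rho> ((i + int t) mod p) = lab \<rho> (int (r + t) mod p)"
      by (simp add: r(1) mod_simps)
    also have "\<dots> = lab \<rho> (int (r + t))" using r(2) \<open>t \<le> N\<close> by (intro agree) simp
    also have "int (r + t) = i + int t + - (p * (i div p))"
      by (simp add: r(1) minus_mult_div_eq_mod)
    finally show "lab \<rho>' (i + int t) = lab \<rho> (i + int t + - (p * (i div p)))" by (simp add: lab')
  qed (use \<open>even p\<close> in simp)
  \<comment> \<open>If all words of \<rho>' occurred in \<rho>, the inverse of one period would
    occur in \<rho>, hence in every window of some length \<open>M\<close>. A copy in \<rho> of the
    first \<open>M\<close> letters of \<rho>' is such a window, so the inverse period would occur in
    \<rho>' itself, at position \<open>c\<close>.\<close>
  have "\<exists>m n. 0 < n \<and> (\<forall>l. segment \<rho> l n \<noteq> segment \<rho>' m n)"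
  proof (rule ccontr)
    assume "\<not> ?thesis"
    then have all: "\<exists>l. segment \<rho> l n = segment \<rho>' m n" if "0 < n" for m n using that by blast
    define n where "n = nat p"
    have n: "0 < n" "int n = p" using p(1) by (simp_all add: n_def)
    obtain l where l: "segment \<rho> l n = segment \<rho>' 0 n" using all n by blast
    obtain l' where l': "segment \<rho> l' n = inv_word (segment \<rho>' 0 n)"
      using quasi_periodic_inverse[OF qp, of n l] l by metis
    obtain M where M: "\<And>k. \<exists>i. k \<le> i \<and> i + int n \<le> k + int M \<and> segment \<rho> i n = segment \<rho> l' n"
      using quasi_periodic_recurrent[OF qp n(1), of l'] by blast
    from M[of 0] n have "0 < M" by auto
    then obtain k where k: "segment \<rho> k M = segment \<rho>' 0 M" using all by blast
    obtain i where i: "k \<le> i" "i + int n \<le> k + int M" "segment \<rho> i n = segment \<rho> l' n"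
      using M by blast
    define s where "s = nat (i - k)"
    define c where "c = int s"
    have ks: "i = k + int s" using i(1) by (simp add: s_def)
    have "lab \<rho>' (c + int t) = inv_letter (lab \<rho>' (int n - 1 - int t))" if "t < n" for t
    proof -
      have "s + t < M" using i(2) that ks by simp
      then have "lab \<rho> (k + int (s + t)) = lab \<rho>' (0 + int (s + t))"
        using k unfolding segment_eq_iff by blast
      then have "lab \<rho>' (c + int t) = lab \<rho> (i + int t)" using ks by (simp add: c_def add.assoc)
      also have "\<dots> = lab (reflect \<rho>') (1 - int n + int t)"
        using i(3) l' that by (simp add: inv_word_segment segment_eq_iff)
      finally show ?thesis by (simp add: lab_reflect algebra_simps)
    qed
    note inverse = this
    \<comment> \<open>For \<open>t = 0\<close>, the letters at \<open>c\<close> and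
      \<open>n - 1\<close> are mutually inverse, so they have the same generator and their positions
      the same parity.\<close>
    have "even (int n - 1 - c)"
      using inverse[OF n(1)] gen_of_lab[OF \<rho>', of c] gen_of_lab[OF \<rho>', of "int n - 1"]
      by (auto split: if_splits)
    then obtain e where e: "int n - 1 - c = 2 * e" by (rule evenE)
    \<comment> \<open>This is a fixed point of the reversal modulo the period: \<open>c + t\<close>
      and \<open>n - 1 - t\<close> are congruent modulo \<open>p\<close>, so the letter there would
      equal its own inverse.\<close>
    define t where "t = nat (e mod p)"
    have "0 \<le> e mod p" "e mod p < p" using p(1) by simp_all
    then have "int t = e mod p" "int t < int n" unfolding n(2) by (simp_all add: t_def)
    then have t: "int t = e mod p" "t < n" by simp_all
    have "int n - 1 - int t = c + int t + 2 * (e - e mod p)" using e t by simp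
    also have "e - e mod p = p * (e div p)" by (simp add: minus_mod_eq_mult_div)
    finally have "(int n - 1 - int t) mod p = (c + int t) mod p"
      by (metis mod_mult_self2 mult.left_commute)
    then have "lab \<rho>' (c + int t) = lab \<rho>' (int n - 1 - int t)" by (simp add: lab')
    then show False using inverse[OF t(2)] inv_letter_neq by metis
  qed
  then obtain m n where mn: "0 < n" "\<And>l. segment \<rho> l n \<noteq> segment \<rho>' m n" by blast
  have 1: "\<not> occurs \<rho> (rev (segment \<rho>' m n)) i" for i
    using mn(2)[of "i + 1 - int n"] by (simp add: occurs_iff_segment)
  \<comment> \<open>An occurrence in the reflected labelling is an occurrence of the inverse word in
    \<rho>, from which condition (2) recovers the word itself.\<close>
  have 2: "\<not> occurs (reflect \<rho>) (rev (segment \<rho>' m n)) i" for i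
  proof
    assume "occurs (reflect \<rho>) (rev (segment \<rho>' m n)) i"
    then have "segment \<rho>' m n = segment (reflect \<rho>) (i + 1 - int n) n"
      by (simp add: occurs_iff_segment)
    also have "\<dots> = inv_word (segment \<rho> (- i) n)" by (simp add: inv_word_segment add.commute)
    finally show False using quasi_periodic_inverse[OF qp, of n "- i"] mn(2) by metis
  qed
  show thesis
  proof (rule that[of \<rho>' "rev (segment \<rho>' m n)" "m + int n - 1"])
    show "rev (segment \<rho>' m n) \<noteq> []" using mn(1) by (metis length_segment length_0_conv rev_is_Nil_conv less_irrefl)
    show "occurs \<rho>' (rev (segment \<rho>' m n)) (m + int n - 1)" by (simp add: occurs_iff_segment)
  qed (use \<rho>' window 1 2 in auto)
qed

section \<open>Elements of Thompson's group\<close>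

lemma dyadic_add: "x \<in> dyadic \<Longrightarrow> y \<in> dyadic \<Longrightarrow> x + y \<in> dyadic"
proof -
  assume "x \<in> dyadic" "y \<in> dyadic"
  then obtain m n :: int and j k :: nat
    where xy: "x = of_int m / 2 ^ j" "y = of_int n / 2 ^ k"
    by (auto simp: dyadic_def)
  have "x + y = of_int (m * 2 ^ k + n * 2 ^ j) / 2 ^ (j + k)"
    unfolding xy by (simp add: field_simps power_add)
  then show ?thesis unfolding dyadic_def by blast
qed

lemma dyadic_minus: "x \<in> dyadic \<Longrightarrow> - x \<in> dyadic"
proof -
  assume "x \<in> dyadic"
  then obtain m :: int and k :: nat where "x = of_int m / 2 ^ k" by (auto simp: dyadic_def)
  then have "- x = of_int (- m) / 2 ^ k" by simp
  then show ?thesis unfolding dyadic_def by blast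
qed

lemma dyadic_diff: "x \<in> dyadic \<Longrightarrow> y \<in> dyadic \<Longrightarrow> x - y \<in> dyadic"
  using dyadic_add[of x "- y"] dyadic_minus by simp

lemma dyadic_fraction: "x \<in> dyadic \<Longrightarrow> x / 2 ^ n \<in> dyadic"
proof -
  assume "x \<in> dyadic"
  then obtain m :: int and k :: nat where "x = of_int m / 2 ^ k" by (auto simp: dyadic_def)
  then have "x / 2 ^ n = of_int m / 2 ^ (k + n)" by (simp add: power_add)
  then show ?thesis unfolding dyadic_def by blast
qed

lemma dyadicI: "x = of_int m / 2 ^ k \<Longrightarrow> x \<in> dyadic"
  by (auto simp: dyadic_def)

lemma dyadic_dense:
  assumes "x < y" obtains d where "d \<in> dyadic" "x < d" "d < y"
proof -
  obtain k where k: "(1 / 2 :: real) ^ k < y - x"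
    using real_arch_pow_inv[of "y - x" "1 / 2"] assms by auto
  define d where "d = of_int (\<lfloor>x * 2 ^ k\<rfloor> + 1) / (2 ^ k :: real)"
  have "x * 2 ^ k < of_int (\<lfloor>x * 2 ^ k\<rfloor> + 1)" "of_int (\<lfloor>x * 2 ^ k\<rfloor> + 1) \<le> x * 2 ^ k + 1"
    by linarith+
  then have "x < d" "d \<le> x + 1 / 2 ^ k" by (simp_all add: d_def field_simps)
  then show thesis
    using that[of d] k dyadicI[of d "\<lfloor>x * 2 ^ k\<rfloor> + 1" k] by (simp add: d_def power_divide)
qed

text \<open>The points of \<open>D\<close> are isolated, so around or beside each point there is an
  interval with a single affine piece, from which differentiability and the derivative can be read
  off.\<close>

lemma thompson_FI:
  assumes f: "f \<in> carrier (homeo_plus \<I>)" and D: "finite D" "D \<subseteq> dyadic"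
    and lin: "\<And>a b. \<lbrakk>0 \<le> a; a < b; b \<le> 1; {a<..<b} \<inter> D = {}\<rbrakk>
      \<Longrightarrow> \<exists>(k::int) c. \<forall>t\<in>{a..b}. f t = 2 powi k * t + c"
  shows "f \<in> thompson_F"
proof -
  have isolated: "\<exists>e>0. ball x e \<inter> (D - {x}) = {}" for x
  proof -
    have "open (- (D - {x}))"
      using D(1) by (intro open_Compl finite_imp_closed) simp
    moreover have "x \<in> - (D - {x})" by simp
    ultimately obtain e where "e > 0" "ball x e \<subseteq> - (D - {x})" using openE by blast
    then show ?thesis by blast
  qed
  have "piecewise_linear f"
    unfolding piecewise_linear_def using D(1) lin by (intro exI[of _ D]) fastforce
  moreover have "f differentiable (at x within \<I>)" if x: "x \<in> \<I> - D" for x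
  proof -
    obtain e where e: "e > 0" "ball x e \<inter> (D - {x}) = {}" using isolated by blast
    define a b where "a = max 0 (x - e)" and "b = min 1 (x + e)"
    have "0 \<le> a" "a < b" "b \<le> 1" using x e(1) by (auto simp: a_def b_def)
    moreover have "{a<..<b} \<subseteq> ball x e" by (auto simp: a_def b_def dist_real_def)
    then have "{a<..<b} \<inter> D = {}" using e(2) x by blast
    ultimately obtain k :: int and c where kc: "\<forall>t\<in>{a..b}. f t = 2 powi k * t + c"
      using lin by blast
    have "((\<lambda>t. 2 powi k * t + c) has_real_derivative 2 powi k) (at x within \<I>)"
      by (auto intro!: derivative_eq_intros)
    then have "(f has_real_derivative 2 powi k) (at x within \<I>)"
    proof (rule has_field_derivative_transform_within[OF _ e(1)])
      fix t assume "t \<in> \<I>" "dist t x < e"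
      then have "t \<in> {a..b}" by (auto simp: a_def b_def dist_real_def)
      then show "2 powi k * t + c = f t" using kc by simp
    qed (use x in auto)
    then show ?thesis using real_differentiable_def by blast
  qed
  moreover have "\<exists>k::int. d = 2 powi k"
    if x: "x \<in> \<I>" and d: "(f has_real_derivative d) (at x within \<I>)" for x d
  proof -
    obtain e where e: "e > 0" "ball x e \<inter> (D - {x}) = {}" using isolated by blast
    \<comment> \<open>The map may happen to be differentiable at a point of \<open>D\<close>. An
      interval on one side of \<open>x\<close>, the right one unless \<open>x = 1\<close>, has no
      point of \<open>D\<close> in its interior and determines the derivative.\<close>
    define a b where "a = (if x < 1 then x else max 0 (x - e))" and "b = min 1 (x + e)"
    have ab: "0 \<le> a" "a < b" "b \<le> 1" "x \<in> {a..b}" using x e(1) by (auto simp: a_def b_def)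
    have "{a<..<b} \<subseteq> ball x e - {x}"
      using x by (auto simp: a_def b_def dist_real_def split: if_splits)
    then have "{a<..<b} \<inter> D = {}" using e(2) by blast
    then obtain k :: int and c where kc: "\<forall>t\<in>{a..b}. f t = 2 powi k * t + c"
      using lin[OF ab(1-3)] by blast
    have "((\<lambda>t. 2 powi k * t + c) has_real_derivative 2 powi k) (at x within {a..b})"
      by (auto intro!: derivative_eq_intros)
    then have "(f has_real_derivative 2 powi k) (at x within {a..b})"
      by (rule has_field_derivative_transform_within[OF _ zero_less_one ab(4)]) (use kc in auto)
    moreover have "(f has_real_derivative d) (at x within {a..b})"
      by (rule has_field_derivative_subset[OF d]) (use ab in auto)
    ultimately have "2 powi k = d"
      using vector_derivative_unique_within_closed_interval[OF ab(2), of x f] ab(4)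
      by (simp add: has_real_derivative_iff_has_vector_derivative)
    then show ?thesis by blast
  qed
  ultimately show ?thesis using f D by (auto simp: thompson_F_def)
qed

text \<open>For \<open>l > 0\<close> this is the identity outside the interval from \<open>a\<close>
  to \<open>a + l\<close> and a push to the right inside it, with slopes 2, 1 and 1/2 in turn. The
  form with max and min gives continuity at once; the middle piece is a translation by
  \<open>l / 4\<close>.\<close>

definition bump :: "real \<Rightarrow> real \<Rightarrow> real \<Rightarrow> real" where
  "bump a l x = max x (min (2 * x - a) (min (x + l / 4) ((x + a + l) / 2)))"

lemma bump_pieces:
  assumes "l > 0"
  shows "x \<le> a \<Longrightarrow> bump a l x = x"
    "a \<le> x \<Longrightarrow> x \<le> a + l / 4 \<Longrightarrow> bump a l x = 2 * x - a"
    "a + l / 4 \<le> x \<Longrightarrow> x \<le> a + l / 2 \<Longrightarrow> bump a l x = x + l / 4"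
    "a + l / 2 \<le> x \<Longrightarrow> x \<le> a + l \<Longrightarrow> bump a l x = (x + a + l) / 2"
    "a + l \<le> x \<Longrightarrow> bump a l x = x"
  using assms unfolding bump_def by (auto simp: max_def min_def)

lemma bump_moves: "l > 0 \<Longrightarrow> bump a l x \<noteq> x \<longleftrightarrow> x \<in> {a<..<a + l}"
  unfolding bump_def by (auto simp: max_def min_def)

lemma strict_mono_bump: "l > 0 \<Longrightarrow> strict_mono (bump a l)"
  unfolding bump_def by (rule strict_monoI) (auto simp: max_def min_def)

lemma continuous_on_bump: "continuous_on S (bump a l)"
  unfolding bump_def by (intro continuous_intros) simp

lemma bump_image:
  assumes "l > 0" "p \<le> a" "a + l \<le> q" shows "bump a l ` {p..q} = {p..q}"
proof
  have "p \<le> q" using assms by simp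
  have ends: "bump a l p = p" "bump a l q = q" using bump_pieces[OF assms(1)] assms by auto
  show "bump a l ` {p..q} \<subseteq> {p..q}"
    using strict_mono_less_eq[OF strict_mono_bump[OF assms(1), of a]] ends
    by (smt (verit) atLeastAtMost_iff image_subset_iff)
  show "{p..q} \<subseteq> bump a l ` {p..q}"
  proof
    fix y assume "y \<in> {p..q}"
    then obtain x where "p \<le> x" "x \<le> q" "bump a l x = y"
      using IVT'[of "bump a l" p y q] ends \<open>p \<le> q\<close> continuous_on_bump by auto
    then show "y \<in> bump a l ` {p..q}" by auto
  qed
qed

lemma bij_bump: assumes "l > 0" shows "bij (bump a l)"
proof (rule bijI)
  show "inj (bump a l)" using strict_mono_bump[OF assms] by (rule strict_mono_imp_inj_on)
  show "surj (bump a l)"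
  proof
    show "UNIV \<subseteq> range (bump a l)"
    proof
      fix y
      have "y \<in> bump a l ` {min y a..max y (a + l)}"
        using bump_image[OF assms, of "min y a" a "max y (a + l)"] by simp
      then show "y \<in> range (bump a l)" by blast
    qed
  qed simp
qed

lemma restrict_bump_homeo_plus:
  assumes "l > 0" "0 \<le> a" "a + l \<le> 1" shows "restrict (bump a l) \<I> \<in> carrier (homeo_plus \<I>)"
proof -
  have "\<exists>g. homeomorphism \<I> \<I> (bump a l) g"
    using bij_bump[OF assms(1)] bump_image[of l 0 a 1] assms
    by (intro homeomorphism_compact continuous_on_bump) (auto simp: bij_def intro: inj_on_subset)
  then obtain g where "homeomorphism \<I> \<I> (bump a l) g" by blast
  then have "homeomorphism \<I> \<I> (restrict (bump a l) \<I>) g" by (rule homeomorphism_cong) auto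
  moreover have "strict_mono_on \<I> (restrict (bump a l) \<I>)"
    using strict_mono_bump[OF assms(1)] by (auto intro!: strict_mono_onI simp: strict_mono_def)
  ultimately show ?thesis by (auto simp: homeo_plus_def homeo_def)
qed

lemma restrict_bump_thompson:
  assumes "a \<in> dyadic" "l \<in> dyadic" "l > 0" "1/16 \<le> a" "a + l \<le> 15/16"
  shows "restrict (bump a l) \<I> \<in> thompson_F_on (1/16) (15/16)"
proof -
  let ?D = "{a, a + l / 4, a + l / 2, a + l}"
  have "l / 4 \<in> dyadic" "l / 2 \<in> dyadic"
    using dyadic_fraction[OF assms(2), of 2] dyadic_fraction[OF assms(2), of 1] by simp_all
  then have D: "?D \<subseteq> dyadic" using assms(1,2) by (simp add: dyadic_add)
  have "restrict (bump a l) \<I> \<in> thompson_F"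
  proof (rule thompson_FI[OF restrict_bump_homeo_plus _ D])
    fix p q :: real assume pq: "0 \<le> p" "p < q" "q \<le> 1" "{p<..<q} \<inter> ?D = {}"
    have sep: "q \<le> d \<or> d \<le> p" if "d \<in> ?D" for d
    proof (rule ccontr)
      assume "\<not> (q \<le> d \<or> d \<le> p)"
      then have "d \<in> {p<..<q} \<inter> ?D" using that by simp
      then show False unfolding pq(4) by simp
    qed
    consider "q \<le> a" | "a \<le> p" "q \<le> a + l / 4" | "a + l / 4 \<le> p" "q \<le> a + l / 2"
      | "a + l / 2 \<le> p" "q \<le> a + l" | "a + l \<le> p"
      using sep[of a] sep[of "a + l / 4"] sep[of "a + l / 2"] sep[of "a + l"] by auto
    then show "\<exists>(k::int) c. \<forall>t\<in>{p..q}. restrict (bump a l) \<I> t = 2 powi k * t + c"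
    proof cases
      case 1
      then show ?thesis using pq by (intro exI[of _ 0]) (auto simp: bump_pieces[OF assms(3)])
    next
      case 2
      then show ?thesis using pq
        by (intro exI[of _ 1] exI[of _ "- a"]) (auto simp: bump_pieces[OF assms(3)])
    next
      case 3
      then show ?thesis using pq
        by (intro exI[of _ 0] exI[of _ "l / 4"]) (auto simp: bump_pieces[OF assms(3)])
    next
      case 4
      then show ?thesis using pq
        by (intro exI[of _ "- 1"] exI[of _ "(a + l) / 2"])
           (auto simp: bump_pieces(4)[OF assms(3)] power_int_minus)
    next
      case 5
      then show ?thesis using pq by (intro exI[of _ 0]) (auto simp: bump_pieces[OF assms(3)])
    qed
  qed (use assms in auto)
  moreover have "supp \<I> (restrict (bump a l) \<I>) \<subseteq> {1/16..15/16}"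
  proof
    fix x assume "x \<in> supp \<I> (restrict (bump a l) \<I>)"
    then have "bump a l x \<noteq> x" by (auto simp: supp_def)
    then show "x \<in> {1/16..15/16}" using bump_moves[OF assms(3)] assms(4,5) by simp
  qed
  ultimately show ?thesis by (simp add: thompson_F_on_def)
qed

text \<open>This provides the element that carries the middle of one cell to the middle of the next.
  A bump of length \<open>l\<close> translates only by \<open>l / 4\<close>, so four bumps of length
  1/2 are composed.\<close>

lemma bump_shift:
  assumes "subgroup (thompson_F_on (1/16) (15/16)) (homeo \<I>)"
  obtains \<gamma> where "\<gamma> \<in> thompson_F_on (1/16) (15/16)" "\<And>t. t \<in> {3/16..5/16} \<Longrightarrow> \<gamma> t = t + 1/2"
proof -
  let ?b = "\<lambda>i. restrict (bump (of_int i / 16) (1/2)) \<I>"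
  have b: "?b i \<in> thompson_F_on (1/16) (15/16)" if "1 \<le> i" "i \<le> 7" for i :: int
  proof (rule restrict_bump_thompson)
    show "of_int i / 16 \<in> dyadic" by (rule dyadicI[of _ i 4]) simp
    show "1 / 2 \<in> dyadic" by (rule dyadicI[of _ 1 1]) simp
    have "1 \<le> real_of_int i" "real_of_int i \<le> 7" using that by simp_all
    then show "1/16 \<le> real_of_int i / 16" "real_of_int i / 16 + 1/2 \<le> 15/16" by simp_all
  qed simp
  \<comment> \<open>The translating piece of the bump starting at \<open>i/16\<close> runs from
    \<open>(i + 2)/16\<close> to \<open>(i + 4)/16\<close>. For \<open>i = 1, 3, 5, 7\<close> each
    of these intervals is mapped onto the next.\<close>
  have shift: "?b i t = t + 1/8"
    if "(of_int i + 2) / 16 \<le> t" "t \<le> (of_int i + 4) / 16" "0 \<le> t" "t \<le> 1" for i :: int and t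
    using bump_pieces(3)[of "1/2" "of_int i / 16" t] that by (simp add: field_simps)
  have mult: "(f \<otimes>\<^bsub>homeo \<I>\<^esub> g) t = g (f t)" if "0 \<le> t" "t \<le> 1" for f g t
    using that by (simp add: homeo_def compose_def)
  let ?\<gamma> = "?b 1 \<otimes>\<^bsub>homeo \<I>\<^esub> ?b 3 \<otimes>\<^bsub>homeo \<I>\<^esub> ?b 5 \<otimes>\<^bsub>homeo \<I>\<^esub> ?b 7"
  show thesis
  proof
    show "?\<gamma> \<in> thompson_F_on (1/16) (15/16)"
      by (intro subgroup.m_closed[OF assms] b) auto
    fix t :: real assume "t \<in> {3/16..5/16}"
    then have t: "3/16 \<le> t" "t \<le> 5/16" by simp_all
    have "?b 1 t = t + 1/8" using t by (intro shift) simp_all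
    moreover have "?b 3 (t + 1/8) = t + 1/8 + 1/8" using t by (intro shift) simp_all
    moreover have "?b 5 (t + 1/8 + 1/8) = t + 1/8 + 1/8 + 1/8" using t by (intro shift) simp_all
    moreover have "?b 7 (t + 1/8 + 1/8 + 1/8) = t + 1/8 + 1/8 + 1/8 + 1/8"
      using t by (intro shift) simp_all
    moreover have "0 \<le> t" "t \<le> 1" using t by simp_all
    ultimately have "?\<gamma> t = t + 1/8 + 1/8 + 1/8 + 1/8"
      by (simp only: mult)
    then show "?\<gamma> t = t + 1/2" by simp
  qed
qed

section \<open>Words acting on the line\<close>

abbreviation parity_gen :: "int \<Rightarrow> ab" where
  "parity_gen j \<equiv> (if even j then gen_a else gen_b)"

text \<open>One family for both generators, so that \<open>chi\<close> and \<open>zeta\<close> are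
  treated together: for an index \<open>j\<close> of the matching parity, each preserves the unit
  interval centred at \<open>j / 2\<close>.\<close>

definition act :: "ab \<Rightarrow> (real \<Rightarrow> ab letter) \<Rightarrow> (real \<Rightarrow> real) \<Rightarrow> real \<Rightarrow> real" where
  "act \<tau> \<rho> f = (case \<tau> of gen_a \<Rightarrow> chi \<rho> f | gen_b \<Rightarrow> zeta \<rho> f)"

abbreviation value_at :: "(real \<Rightarrow> ab letter) \<Rightarrow> (ab \<times> (real \<Rightarrow> real)) letter list \<Rightarrow> real \<Rightarrow> real" where
  "value_at \<rho> \<equiv> word_value (homeo_plus UNIV) (\<lambda>(\<tau>, f). act \<tau> \<rho> f)"

section \<open>The action of a single generator\<close>

lemma homeo_plus_UNIV_simps [simp]:
  "f \<otimes>\<^bsub>homeo_plus UNIV\<^esub> g = (\<lambda>x. g (f x))" "\<one>\<^bsub>homeo_plus UNIV\<^esub> = (\<lambda>x. x)"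
  by (simp_all add: homeo_plus_def homeo_def compose_def restrict_def)

lemma homeo_plus_UNIV_inv:
  assumes "f \<in> carrier (homeo_plus UNIV)"
  shows "f ((inv\<^bsub>homeo_plus UNIV\<^esub> f) x) = x" "(inv\<^bsub>homeo_plus UNIV\<^esub> f) (f x) = x"
  using fun_cong[OF group.l_inv[OF group_homeo_plus assms], of x]
    fun_cong[OF group.r_inv[OF group_homeo_plus assms], of x] by simp_all

lemma homeo_plus_mem:
  assumes "f \<in> carrier (homeo_plus \<I>)" "t \<in> \<I>" shows "f t \<in> \<I>"
  using assms by (auto simp: homeo_plus_def homeo_def homeomorphism_def)

lemma homeo_plus_imp_homeo: "f \<in> carrier (homeo_plus S) \<Longrightarrow> f \<in> carrier (homeo S)"
  by (simp add: homeo_plus_def)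

lemma act_apply:
  assumes "f \<in> carrier (homeo_plus \<I>)" "t \<in> \<I>" "\<tau> = parity_gen j"
  shows "act \<tau> \<rho> f (of_int j / 2 - 1/2 + t) =
    of_int j / 2 - 1/2 + (if lab \<rho> j = Pos \<tau> then f t else flip f t)"
proof (cases "even j")
  case True
  then obtain n where "j = 2 * n" by (rule evenE)
  then show ?thesis using chi_apply[OF assms(1,2), of \<rho> n] assms(3)
    by (simp add: act_def lab_def)
next
  case False
  then obtain n where "j = 2 * n + 1" by (rule oddE)
  then show ?thesis using zeta_apply[OF assms(1,2), of \<rho> n] assms(3)
    by (simp add: act_def lab_def add_divide_distrib)
qed

lemma act_homeo_plus:
  "f \<in> carrier (homeo_plus \<I>) \<Longrightarrow> act \<tau> \<rho> f \<in> carrier (homeo_plus UNIV)"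
  by (cases \<tau>) (simp_all add: act_def chi_homeo_plus zeta_homeo_plus)

lemma centred_coordinates:
  obtains j t where "\<tau> = parity_gen j" "t \<in> \<I>" "x = of_int j / 2 - 1/2 + t"
proof (cases \<tau>)
  case gen_a
  let ?n = "\<lfloor>x + 1/2\<rfloor>"
  have "0 \<le> x + 1/2 - of_int ?n" "x + 1/2 - of_int ?n \<le> 1" by linarith+
  then show thesis using gen_a that[of "2 * ?n" "x + 1/2 - of_int ?n"] by simp
next
  case gen_b
  let ?n = "\<lfloor>x\<rfloor>"
  have "0 \<le> x - of_int ?n" "x - of_int ?n \<le> 1" by linarith+
  then show thesis using gen_b that[of "2 * ?n + 1" "x - of_int ?n"] by (simp add: add_divide_distrib)
qed

lemma flip_mult_apply:
  assumes "f \<in> carrier (homeo_plus \<I>)" "g \<in> carrier (homeo_plus \<I>)" "t \<in> \<I>"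
  shows "flip (f \<otimes>\<^bsub>homeo \<I>\<^esub> g) t = flip g (flip f t)"
proof -
  interpret group "homeo \<I>" by (rule group_homeo)
  note c = homeo_plus_imp_homeo[OF assms(1)] homeo_plus_imp_homeo[OF assms(2)]
  have "1 - t \<in> \<I>" using assms(3) by simp
  then have "(f \<otimes>\<^bsub>homeo \<I>\<^esub> g) (1 - t) = g (f (1 - t))"
    by (simp add: homeo_def compose_def)
  then show ?thesis
    using flip_apply[OF m_closed[OF c] assms(3)] flip_apply[OF c(1) assms(3)]
      flip_apply[OF c(2) homeo_plus_mem[OF flip_homeo_plus[OF assms(1)] assms(3)]] by simp
qed

lemma act_mult:
  assumes "f \<in> carrier (homeo_plus \<I>)" "g \<in> carrier (homeo_plus \<I>)"
  shows "act \<tau> \<rho> (f \<otimes>\<^bsub>homeo \<I>\<^esub> g) x = act \<tau> \<rho> g (act \<tau> \<rho> f x)"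
proof -
  obtain j t where jt: "\<tau> = parity_gen j" "t \<in> \<I>" "x = of_int j / 2 - 1/2 + t"
    by (rule centred_coordinates)
  have fg: "f \<otimes>\<^bsub>homeo \<I>\<^esub> g \<in> carrier (homeo_plus \<I>)"
    using subgroup.m_closed[OF subgroup_homeo_plus assms] .
  have "(f \<otimes>\<^bsub>homeo \<I>\<^esub> g) t = g (f t)"
    using jt(2) by (simp add: homeo_def compose_def)
  then show ?thesis
    unfolding jt(3) act_apply[OF fg jt(2,1)] act_apply[OF assms(1) jt(2,1)]
    using act_apply[OF assms(2) homeo_plus_mem[OF assms(1) jt(2)] jt(1), of \<rho>]
      act_apply[OF assms(2) homeo_plus_mem[OF flip_homeo_plus[OF assms(1)] jt(2)] jt(1), of \<rho>]
      flip_mult_apply[OF assms jt(2)]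
    by (simp del: of_int_add)
qed

lemma act_one: "act \<tau> \<rho> \<one>\<^bsub>homeo \<I>\<^esub> x = x"
proof -
  obtain j t where jt: "\<tau> = parity_gen j" "t \<in> \<I>" "x = of_int j / 2 - 1/2 + t"
    by (rule centred_coordinates)
  have one: "\<one>\<^bsub>homeo \<I>\<^esub> \<in> carrier (homeo_plus \<I>)"
    using subgroup.one_closed[OF subgroup_homeo_plus] .
  have "\<one>\<^bsub>homeo \<I>\<^esub> t = t" "flip \<one>\<^bsub>homeo \<I>\<^esub> t = t"
    using jt(2) flip_apply[OF homeo_plus_imp_homeo[OF one] jt(2)] by (simp_all add: homeo_def)
  then show ?thesis unfolding jt(3) act_apply[OF one jt(2,1)] by simp
qed

lemma act_inv:
  assumes "f \<in> carrier (homeo_plus \<I>)"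
  shows "inv\<^bsub>homeo_plus UNIV\<^esub> (act \<tau> \<rho> f) = act \<tau> \<rho> (inv\<^bsub>homeo \<I>\<^esub> f)"
proof (rule group.inv_equality[OF group_homeo_plus])
  have inv: "inv\<^bsub>homeo \<I>\<^esub> f \<in> carrier (homeo_plus \<I>)"
    using subgroup.m_inv_closed[OF subgroup_homeo_plus assms] .
  have "inv\<^bsub>homeo \<I>\<^esub> f \<otimes>\<^bsub>homeo \<I>\<^esub> f = \<one>\<^bsub>homeo \<I>\<^esub>"
    using group.l_inv[OF group_homeo homeo_plus_imp_homeo[OF assms]] .
  then have "act \<tau> \<rho> f (act \<tau> \<rho> (inv\<^bsub>homeo \<I>\<^esub> f) x) = x" for x
    using act_mult[OF inv assms] act_one by metis
  then show "act \<tau> \<rho> (inv\<^bsub>homeo \<I>\<^esub> f) \<otimes>\<^bsub>homeo_plus UNIV\<^esub> act \<tau> \<rho> f = \<one>\<^bsub>homeo_plus UNIV\<^esub>"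
    by simp
qed (use assms inv act_homeo_plus subgroup.m_inv_closed[OF subgroup_homeo_plus] in auto)

text \<open>Turning an interval around exchanges a map with its flip, and inverting the letter at
  its centre exchanges them back.\<close>

lemma act_reflect:
  assumes "f \<in> carrier (homeo_plus \<I>)" "labelling \<rho>"
  shows "act \<tau> (reflect \<rho>) f (- x) = - act \<tau> \<rho> f x"
proof -
  obtain j t where jt: "\<tau> = parity_gen j" "t \<in> \<I>" "x = of_int j / 2 - 1/2 + t"
    by (rule centred_coordinates)
  have t': "1 - t \<in> \<I>" using jt(2) by simp
  have x: "- x = of_int (- j) / 2 - 1/2 + (1 - t)" using jt(3) by simp
  have j: "\<tau> = parity_gen (- j)" using jt(1) by simp
  have "lab \<rho> j = Pos \<tau> \<or> lab \<rho> j = Neg \<tau>"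
    using gen_of_lab[OF assms(2), of j] jt(1) by (cases "lab \<rho> j") auto
  moreover have "flip f (1 - t) = 1 - f t" "flip f t = 1 - f (1 - t)"
    using flip_apply[OF homeo_plus_imp_homeo[OF assms(1)]] t' jt(2) by simp_all
  ultimately show ?thesis
    unfolding x act_apply[OF assms(1) t' j] unfolding jt(3) act_apply[OF assms(1) jt(2,1)]
    by (auto simp: lab_reflect)
qed

lemma act_displacement:
  assumes "f \<in> carrier (homeo_plus \<I>)" shows "\<bar>act \<tau> \<rho> f x - x\<bar> \<le> 1"
proof -
  obtain j t where jt: "\<tau> = parity_gen j" "t \<in> \<I>" "x = of_int j / 2 - 1/2 + t"
    by (rule centred_coordinates)
  show ?thesis
    unfolding jt(3) act_apply[OF assms jt(2,1)]
    using homeo_plus_mem[OF assms jt(2)] homeo_plus_mem[OF flip_homeo_plus[OF assms] jt(2)] jt(2)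
    by auto
qed

text \<open>The image of \<open>x\<close> depends only on the letter at the centre of its interval,
  at distance at most 1/2. An integer translation shifts indices by an even number and so respects
  the two generators.\<close>

lemma act_local:
  assumes "f \<in> carrier (homeo_plus \<I>)"
    and "\<And>j. \<bar>of_int j / 2 - x\<bar> \<le> 1/2 \<Longrightarrow> lab \<rho>' j = lab \<rho> (j + 2 * m)"
  shows "act \<tau> \<rho> f (x + of_int m) = act \<tau> \<rho>' f x + of_int m"
proof -
  obtain j t where jt: "\<tau> = parity_gen j" "t \<in> \<I>" "x = of_int j / 2 - 1/2 + t"
    by (rule centred_coordinates)
  have x: "x + of_int m = of_int (j + 2 * m) / 2 - 1/2 + t" using jt(3) by simp
  have j: "\<tau> = parity_gen (j + 2 * m)" using jt(1) by simp
  have "lab \<rho>' j = lab \<rho> (j + 2 * m)"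
  proof (rule assms(2))
    have "of_int j / 2 - x = 1/2 - t" using jt(3) by simp
    moreover have "\<bar>1/2 - t\<bar> \<le> 1/2" using jt(2) by (intro abs_leI) simp_all
    ultimately show "\<bar>of_int j / 2 - x\<bar> \<le> 1/2" by simp
  qed
  then show ?thesis
    unfolding x act_apply[OF assms(1) jt(2) j] unfolding jt(3) act_apply[OF assms(1) jt(2,1)]
    by simp
qed

text \<open>The data on the unit interval: words are written in the maps of \<open>N\<close>, and
  elements of Thompson's group become words through \<open>N_generates\<close>.\<close>

locale thompson_generators =
  fixes N :: "(real \<Rightarrow> real) set"
  assumes N_homeo: "N \<subseteq> carrier (homeo_plus \<I>)"
    and thompson_subgroup: "subgroup (thompson_F_on (1/16) (15/16)) (homeo \<I>)"
    and N_generates: "thompson_F_on (1/16) (15/16) \<subseteq> generate (homeo \<I>) N"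
begin

section \<open>Words and their values under different labellings\<close>

abbreviation "words \<equiv> {w. gen_of ` set w \<subseteq> UNIV \<times> N}"

lemma act_closed: "(\<lambda>(\<tau>, f). act \<tau> \<rho> f) \<in> UNIV \<times> N \<rightarrow> carrier (homeo_plus UNIV)"
  using N_homeo act_homeo_plus by auto

lemma words_inv: "w \<in> words \<Longrightarrow> inv_word w \<in> words"
  using gen_of_inv_word[of w] by simp

lemma words_append: "u \<in> words \<Longrightarrow> v \<in> words \<Longrightarrow> u @ v \<in> words"
  by auto

lemma value_closed: "w \<in> words \<Longrightarrow> value_at \<rho> w \<in> carrier (homeo_plus UNIV)"
  using group.word_value_closed[OF group_homeo_plus act_closed] by simp

lemma value_append:
  "u \<in> words \<Longrightarrow> v \<in> words \<Longrightarrow> value_at \<rho> (u @ v) x = value_at \<rho> v (value_at \<rho> u x)"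
  using group.word_value_append[OF group_homeo_plus act_closed, of u v \<rho>] by simp

lemma value_inv:
  assumes "w \<in> words"
  shows "value_at \<rho> (inv_word w) (value_at \<rho> w x) = x" "value_at \<rho> w (value_at \<rho> (inv_word w) x) = x"
  using group.word_value_inv_word[OF group_homeo_plus act_closed, of w \<rho>] assms
    homeo_plus_UNIV_inv[OF value_closed[OF assms]] by simp_all

text \<open>Turning the line around intertwines the actions for \<rho> and its reflection, letter by
  letter. The behaviour around inverse letters is thereby obtained from that around the letters
  themselves.\<close>

lemma value_reflect:
  assumes \<rho>: "labelling \<rho>" and "w \<in> words"
  shows "value_at (reflect \<rho>) w (- x) = - value_at \<rho> w x"
  using assms(2)
proof (induction w arbitrary: x)
  case (Cons l w)
  obtain \<tau> f where f: "gen_of l = (\<tau>, f)" "f \<in> carrier (homeo_plus \<I>)"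
    using Cons.prems N_homeo by (cases "gen_of l") auto
  have inv: "inv\<^bsub>homeo \<I>\<^esub> f \<in> carrier (homeo_plus \<I>)"
    using subgroup.m_inv_closed[OF subgroup_homeo_plus f(2)] .
  have "letter_value (homeo_plus UNIV) (\<lambda>(\<tau>, f). act \<tau> (reflect \<rho>) f) l (- x)
      = - letter_value (homeo_plus UNIV) (\<lambda>(\<tau>, f). act \<tau> \<rho> f) l x"
    using f by (cases l) (simp_all add: act_inv act_reflect \<rho> inv)
  then show ?case using Cons by simp
qed simp

text \<open>Each letter of the word moves a point by at most 1 and consults only a label within 1/2
  of it, so the length of the word bounds the radius on which its value depends.\<close>

lemma value_local:
  assumes "w \<in> words"
    and "\<And>j. \<bar>of_int j / 2 - x\<bar> \<le> real (length w) \<Longrightarrow> lab \<rho>' j = lab \<rho> (j + 2 * m)"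
  shows "value_at \<rho> w (x + of_int m) = value_at \<rho>' w x + of_int m"
  using assms
proof (induction w arbitrary: x)
  case (Cons l w)
  obtain \<tau> f where f: "gen_of l = (\<tau>, f)" "f \<in> carrier (homeo_plus \<I>)"
    using Cons.prems(1) N_homeo by (cases "gen_of l") auto
  have inv: "inv\<^bsub>homeo \<I>\<^esub> f \<in> carrier (homeo_plus \<I>)"
    using subgroup.m_inv_closed[OF subgroup_homeo_plus f(2)] .
  let ?l = "\<lambda>\<rho>. letter_value (homeo_plus UNIV) (\<lambda>(\<tau>, f). act \<tau> \<rho> f) l"
  have l: "?l \<rho> = act \<tau> \<rho> (case l of Pos _ \<Rightarrow> f | Neg _ \<Rightarrow> inv\<^bsub>homeo \<I>\<^esub> f)"
    and c: "(case l of Pos _ \<Rightarrow> f | Neg _ \<Rightarrow> inv\<^bsub>homeo \<I>\<^esub> f) \<in> carrier (homeo_plus \<I>)" for \<rho>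
    using f inv by (cases l; simp add: act_inv)+
  have "?l \<rho> (x + of_int m) = ?l \<rho>' x + of_int m"
    unfolding l by (rule act_local[OF c]) (rule Cons.prems(2), simp)
  moreover have "value_at \<rho> w (?l \<rho>' x + of_int m) = value_at \<rho>' w (?l \<rho>' x) + of_int m"
  proof (rule Cons.IH)
    fix j assume "\<bar>of_int j / 2 - ?l \<rho>' x\<bar> \<le> real (length w)"
    moreover have "\<bar>?l \<rho>' x - x\<bar> \<le> 1" unfolding l by (rule act_displacement[OF c])
    ultimately show "lab \<rho>' j = lab \<rho> (j + 2 * m)" by (intro Cons.prems(2)) simp
  qed (use Cons.prems(1) in simp)
  ultimately show ?case by simp
qed simp

lemma thompson_homeo_plus: "f \<in> thompson_F_on (1/16) (15/16) \<Longrightarrow> f \<in> carrier (homeo_plus \<I>)"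
  by (simp add: thompson_F_on_def thompson_F_def)

text \<open>The same word serves for all labellings, since \<open>act\<close> is multiplicative for
  each of them; this uniformity makes different labellings comparable.\<close>

lemma thompson_word:
  assumes "f \<in> thompson_F_on (1/16) (15/16)"
  obtains w where "w \<in> words" "\<And>\<rho>. value_at \<rho> w = act \<tau> \<rho> f"
proof -
  have "f \<in> generate (homeo \<I>) N" using assms N_generates by blast
  then have "f \<in> carrier (homeo_plus \<I>) \<and> (\<exists>w\<in>words. \<forall>\<rho>. value_at \<rho> w = act \<tau> \<rho> f)"
  proof induction
    case one
    show ?case
      using subgroup.one_closed[OF subgroup_homeo_plus]
      by (auto intro!: exI[of _ "[]"] simp: act_one fun_eq_iff)
  next
    case (incl f)
    then show ?case using N_homeo by (auto intro!: exI[of _ "[Pos (\<tau>, f)]"])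
  next
    case (inv f)
    then have "f \<in> carrier (homeo_plus \<I>)" using N_homeo by auto
    then show ?case
      using inv subgroup.m_inv_closed[OF subgroup_homeo_plus]
      by (auto intro!: exI[of _ "[Neg (\<tau>, f)]"] simp: act_inv)
  next
    case (eng f g)
    then obtain u v where "u \<in> words" "\<And>\<rho>. value_at \<rho> u = act \<tau> \<rho> f"
      "v \<in> words" "\<And>\<rho>. value_at \<rho> v = act \<tau> \<rho> g" by blast
    then have "u @ v \<in> words" "\<And>\<rho>. value_at \<rho> (u @ v) = act \<tau> \<rho> (f \<otimes>\<^bsub>homeo \<I>\<^esub> g)"
      using eng.IH words_append[of u v] by (simp_all add: value_append act_mult fun_eq_iff)
    moreover have "f \<otimes>\<^bsub>homeo \<I>\<^esub> g \<in> carrier (homeo_plus \<I>)"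
      using eng.IH subgroup.m_closed[OF subgroup_homeo_plus] by simp
    ultimately show ?case by metis
  qed
  then show thesis using that by blast
qed

end

section \<open>Words detecting a pattern\<close>

text \<open>A map of the cell from 0 to 1/2 that moves only points of its middle part, where the
  element of \<open>shift_element\<close> is an exact translation. The middle part is symmetric
  about 1/4, so reflections of cell maps are cell maps; bijectivity on the whole line makes
  \<open>inv_into UNIV\<close> a true inverse.\<close>

definition cell_map :: "(real \<Rightarrow> real) \<Rightarrow> bool" where
  "cell_map h \<longleftrightarrow> bij h \<and> (\<forall>s. s \<notin> {3/16<..<5/16} \<longrightarrow> h s = s)"

lemma cell_map_outside: "cell_map h \<Longrightarrow> s \<notin> {3/16<..<5/16} \<Longrightarrow> h s = s"
  by (simp add: cell_map_def)

lemma cell_map_bij: "cell_map h \<Longrightarrow> bij h"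
  by (simp add: cell_map_def)

lemma cell_map_inside:
  assumes "cell_map h" "s \<in> {3/16<..<5/16}" shows "h s \<in> {3/16<..<5/16}"
proof (rule ccontr)
  assume "h s \<notin> {3/16<..<5/16}"
  then have "h (h s) = h s" by (rule cell_map_outside[OF assms(1)])
  then have "h s = s" using cell_map_bij[OF assms(1)] by (metis bij_pointE)
  then show False using \<open>h s \<notin> {3/16<..<5/16}\<close> assms(2) by simp
qed

lemma cell_map_cell: "cell_map h \<Longrightarrow> s \<in> {0..1/2} \<Longrightarrow> h s \<in> {0..1/2}"
  using cell_map_inside[of h s] cell_map_outside[of h s] by (cases "s \<in> {3/16<..<5/16}") auto

lemma cell_map_id: "cell_map (\<lambda>s. s)"
  by (simp add: cell_map_def bij_id[unfolded id_def])

lemma cell_map_compose: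
  assumes "cell_map g" "cell_map h" shows "cell_map (\<lambda>s. g (h s))"
  using assms bij_comp[of h g] by (simp add: cell_map_def comp_def)

lemma cell_map_inv:
  assumes "cell_map h" shows "cell_map (inv_into UNIV h)"
  unfolding cell_map_def using assms
  by (metis bij_imp_bij_inv cell_map_bij cell_map_outside bij_inv_eq_iff)

lemma cell_map_reflect:
  assumes "cell_map h" shows "cell_map (\<lambda>s. 1/2 - h (1/2 - s))"
proof -
  have r: "bij (\<lambda>s::real. 1/2 - s)" by (rule involuntory_imp_bij) simp
  have "bij (\<lambda>s. 1/2 - h (1/2 - s))"
    using bij_comp[OF bij_comp[OF r cell_map_bij[OF assms]] r] by (simp add: comp_def)
  moreover have "1/2 - h (1/2 - s) = s" if "s \<notin> {3/16<..<5/16}" for s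
    using cell_map_outside[OF assms, of "1/2 - s"] that by auto
  ultimately show ?thesis by (simp add: cell_map_def)
qed

text \<open>With maps acting on the right this is the product of \<open>h\<close> inverse,
  \<open>f\<close> inverse, \<open>h\<close> and \<open>f\<close>, the order of the word in
  \<open>commutator_cell\<close>.\<close>

definition commutator :: "(real \<Rightarrow> real) \<Rightarrow> (real \<Rightarrow> real) \<Rightarrow> real \<Rightarrow> real" where
  "commutator h f s = f (h (inv_into UNIV f (inv_into UNIV h s)))"

lemma cell_map_commutator:
  assumes "cell_map h" "cell_map f" shows "cell_map (commutator h f)"
  using cell_map_compose[OF assms(2) cell_map_compose[OF assms(1)
      cell_map_compose[OF cell_map_inv[OF assms(2)] cell_map_inv[OF assms(1)]]]]
  by (simp add: commutator_def[abs_def])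

text \<open>The two inverses take \<open>h p\<close> to \<open>p\<close> and leave it there, so the
  commutator sends \<open>h p\<close> to \<open>f (h p)\<close>.\<close>

lemma commutator_moves:
  assumes "bij h" "bij f" "f p = p" "f (h p) \<noteq> h p" shows "commutator h f (h p) \<noteq> h p"
  using assms by (simp add: commutator_def bij_is_inj) (metis bij_inv_eq_iff)

context thompson_generators
begin

text \<open>The action is prescribed only around the letters \<open>z\<close>; \<open>value_reflect\<close> determines it around
  the letters \<open>inv_letter z\<close>, and the two kinds of intervals cover the line. The pattern
  \<open>z # v\<close> is read from right to left, as in \<open>occurs\<close>.\<close>

definition encodes ::
  "(ab \<times> (real \<Rightarrow> real)) letter list \<Rightarrow> ab letter list \<Rightarrow> ab letter \<Rightarrow> (real \<Rightarrow> real) \<Rightarrow> bool" where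
  "encodes w v z h \<longleftrightarrow> (\<forall>\<rho> j. labelling \<rho> \<longrightarrow> lab \<rho> j = z \<longrightarrow> (\<forall>s\<in>{0..1/2}.
     value_at \<rho> w (of_int j / 2 + s) = of_int j / 2 + s \<and>
     value_at \<rho> w (of_int j / 2 - 1/2 + s) =
       of_int j / 2 - 1/2 + (if occurs \<rho> v (j - 1) then h s else s)))"

lemma encodesD:
  assumes "encodes w v z h" "labelling \<rho>" "lab \<rho> j = z" "s \<in> {0..1/2}"
  shows "value_at \<rho> w (of_int j / 2 + s) = of_int j / 2 + s"
    "value_at \<rho> w (of_int j / 2 - 1/2 + s) =
       of_int j / 2 - 1/2 + (if occurs \<rho> v (j - 1) then h s else s)"
  using assms unfolding encodes_def by blast+

lemma lab_parity: "labelling \<rho> \<Longrightarrow> lab \<rho> j = z \<Longrightarrow> gen_of z = parity_gen j"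
  using gen_of_lab by metis

lemma letter_cases: obtains "z = Pos (gen_of z)" | "z = Neg (gen_of z)"
  by (cases z) auto

text \<open>The base of the induction: the empty pattern precedes every \<open>z\<close>, so the
  word acts in all cells before letters \<open>z\<close>. At a negative letter the generator acts
  flipped, so the bump is placed in the right half instead.\<close>

lemma left_element:
  assumes "a \<in> dyadic" "l \<in> dyadic" "l > 0" "3/16 \<le> a" "a + l \<le> 5/16"
  obtains w h where "w \<in> words" "cell_map h" "\<And>s. h s \<noteq> s \<longleftrightarrow> s \<in> {a<..<a + l}" "encodes w [] z h"
proof -
  define \<tau> where "\<tau> = gen_of z"
  consider (Pos) "z = Pos \<tau>" | (Neg) "z = Neg \<tau>" unfolding \<tau>_def by (rule letter_cases)
  then show thesis
  proof cases
    case Pos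
    let ?f = "restrict (bump a l) \<I>"
    have f: "?f \<in> thompson_F_on (1/16) (15/16)"
      using assms by (intro restrict_bump_thompson) auto
    obtain w where w: "w \<in> words" "\<And>\<rho>. value_at \<rho> w = act \<tau> \<rho> ?f"
      using thompson_word[OF f] by blast
    show thesis
    proof (rule that[OF w(1)])
      show "cell_map (bump a l)"
        unfolding cell_map_def using assms bij_bump bump_pieces(1,5)[OF assms(3)]
        by (auto simp: not_less)
      show "bump a l s \<noteq> s \<longleftrightarrow> s \<in> {a<..<a + l}" for s using bump_moves[OF assms(3)] .
      show "encodes w [] z (bump a l)"
        unfolding encodes_def
      proof (intro allI impI ballI conjI)
        fix \<rho> j and s :: real assume \<rho>: "labelling \<rho>" "lab \<rho> j = z" and s: "s \<in> {0..1/2}"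
        have \<tau>: "\<tau> = parity_gen j" using lab_parity[OF \<rho>] by (simp add: \<tau>_def)
        have "1/2 + s \<in> \<I>" "s \<in> \<I>" using s by auto
        note app = this[THEN act_apply[OF thompson_homeo_plus[OF f] _ \<tau>, of _ \<rho>]]
        have "bump a l (1/2 + s) = 1/2 + s" using s assms by (intro bump_pieces(5)) auto
        then show "value_at \<rho> w (of_int j / 2 + s) = of_int j / 2 + s"
          using app(1) \<rho>(2) Pos s by (simp add: w(2))
        show "value_at \<rho> w (of_int j / 2 - 1/2 + s)
            = of_int j / 2 - 1/2 + (if occurs \<rho> [] (j - 1) then bump a l s else s)"
          using app(2) \<rho>(2) Pos s by (simp add: w(2))
      qed
    qed
  next
    case Neg
    \<comment> \<open>The interval from \<open>b\<close> to \<open>b + l\<close> is the mirror image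
      of the one from \<open>a\<close> to \<open>a + l\<close>, so flipping brings the support back
      to the left half.\<close>
    define b where "b = 1 - a - l"
    have b: "11/16 \<le> b" "b + l \<le> 13/16" "b \<in> dyadic"
      using assms dyadic_diff dyadicI[of 1 1 0] by (auto simp: b_def)
    let ?f = "restrict (bump b l) \<I>"
    have f: "?f \<in> thompson_F_on (1/16) (15/16)"
      using assms b by (intro restrict_bump_thompson) auto
    obtain w where w: "w \<in> words" "\<And>\<rho>. value_at \<rho> w = act \<tau> \<rho> ?f"
      using thompson_word[OF f] by blast
    let ?h = "\<lambda>s. 1 - bump b l (1 - s)"
    have flip: "flip ?f s = ?h s" if "s \<in> \<I>" for s
      using flip_apply[OF homeo_plus_imp_homeo[OF thompson_homeo_plus[OF f]] that] that by simp
    have moves: "?h s \<noteq> s \<longleftrightarrow> s \<in> {a<..<a + l}" for s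
      using bump_moves[OF assms(3), of b "1 - s"] by (auto simp: b_def)
    show thesis
    proof (rule that[OF w(1) _ moves])
      have r: "bij (\<lambda>s::real. 1 - s)" by (rule involuntory_imp_bij) simp
      have "bij ?h"
        using bij_comp[OF bij_comp[OF r bij_bump[OF assms(3)]] r] by (simp add: comp_def)
      moreover have "?h s = s" if "s \<notin> {3/16<..<5/16}" for s
        using moves[of s] assms(4,5) that by auto
      ultimately show "cell_map ?h" by (simp add: cell_map_def)
      show "encodes w [] z ?h"
        unfolding encodes_def
      proof (intro allI impI ballI conjI)
        fix \<rho> j and s :: real assume \<rho>: "labelling \<rho>" "lab \<rho> j = z" and s: "s \<in> {0..1/2}"
        have \<tau>: "\<tau> = parity_gen j" using lab_parity[OF \<rho>] by (simp add: \<tau>_def)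
        have mem: "1/2 + s \<in> \<I>" "s \<in> \<I>" using s by auto
        note app = mem[THEN act_apply[OF thompson_homeo_plus[OF f] _ \<tau>, of _ \<rho>]]
        have "?h (1/2 + s) = 1/2 + s" using moves[of "1/2 + s"] s assms(4,5) by auto
        then show "value_at \<rho> w (of_int j / 2 + s) = of_int j / 2 + s"
          using app(1) flip[OF mem(1)] \<rho>(2) Neg by (simp add: w(2))
        show "value_at \<rho> w (of_int j / 2 - 1/2 + s)
            = of_int j / 2 - 1/2 + (if occurs \<rho> [] (j - 1) then ?h s else s)"
          using app(2) flip[OF mem(2)] \<rho>(2) Neg by (simp add: w(2))
      qed
    qed
  qed
qed

text \<open>At a positive letter the map of \<open>bump_shift\<close> is used as it is. At a
  negative one its inverse is used: the inverse moves points left, and the flip turns this into the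
  required move to the right.\<close>

lemma shift_element:
  obtains w \<phi> where "w \<in> words" "\<phi> \<in> carrier (homeo_plus \<I>)" "\<And>t. t \<in> {3/16..5/16} \<Longrightarrow> \<phi> t = t + 1/2"
    "\<And>\<rho> j t. \<lbrakk>labelling \<rho>; lab \<rho> j = z; t \<in> \<I>\<rbrakk>
      \<Longrightarrow> value_at \<rho> w (of_int j / 2 - 1/2 + t) = of_int j / 2 - 1/2 + \<phi> t"
proof -
  define \<tau> where "\<tau> = gen_of z"
  obtain \<gamma> where \<gamma>: "\<gamma> \<in> thompson_F_on (1/16) (15/16)" "\<And>t. t \<in> {3/16..5/16} \<Longrightarrow> \<gamma> t = t + 1/2"
    using bump_shift[OF thompson_subgroup] by blast
  consider (Pos) "z = Pos \<tau>" | (Neg) "z = Neg \<tau>" unfolding \<tau>_def by (rule letter_cases)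
  then show thesis
  proof cases
    case Pos
    obtain w where w: "w \<in> words" "\<And>\<rho>. value_at \<rho> w = act \<tau> \<rho> \<gamma>"
      using thompson_word[OF \<gamma>(1)] by blast
    show thesis
    proof (rule that[OF w(1) thompson_homeo_plus[OF \<gamma>(1)] \<gamma>(2)])
      fix \<rho> j and t :: real assume \<rho>: "labelling \<rho>" "lab \<rho> j = z" and t: "t \<in> \<I>"
      have \<tau>: "\<tau> = parity_gen j" using lab_parity[OF \<rho>] by (simp add: \<tau>_def)
      show "value_at \<rho> w (of_int j / 2 - 1/2 + t) = of_int j / 2 - 1/2 + \<gamma> t"
        unfolding w(2) act_apply[OF thompson_homeo_plus[OF \<gamma>(1)] t \<tau>] using \<rho>(2) Pos by simp
    qed
  next
    case Neg
    let ?f = "inv\<^bsub>homeo \<I>\<^esub> \<gamma>"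
    have f: "?f \<in> thompson_F_on (1/16) (15/16)"
      using subgroup.m_inv_closed[OF thompson_subgroup \<gamma>(1)] .
    note fh = thompson_homeo_plus[OF f]
    obtain w where w: "w \<in> words" "\<And>\<rho>. value_at \<rho> w = act \<tau> \<rho> ?f"
      using thompson_word[OF f] by blast
    have "\<gamma> \<otimes>\<^bsub>homeo \<I>\<^esub> ?f = \<one>\<^bsub>homeo \<I>\<^esub>"
      using group.r_inv[OF group_homeo homeo_plus_imp_homeo[OF thompson_homeo_plus[OF \<gamma>(1)]]] .
    then have "(\<gamma> \<otimes>\<^bsub>homeo \<I>\<^esub> ?f) t = \<one>\<^bsub>homeo \<I>\<^esub> t" for t by (rule fun_cong)
    then have "compose \<I> ?f \<gamma> t = (\<lambda>x\<in>\<I>. x) t" for t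
      unfolding homeo_def[of \<I>] monoid.simps using homeo_def by simp
    then have linv: "?f (\<gamma> t) = t" if "t \<in> \<I>" for t
      using that by (metis compose_eq restrict_apply')
    show thesis
    proof (rule that[OF w(1) flip_homeo_plus[OF fh]])
      fix t :: real assume t: "t \<in> {3/16..5/16}"
      then have "\<gamma> (1/2 - t) = 1 - t" using \<gamma>(2)[of "1/2 - t"] by simp
      then have "?f (1 - t) = 1/2 - t" using linv[of "1/2 - t"] t by simp
      then show "flip ?f t = t + 1/2" using flip_apply[OF homeo_plus_imp_homeo[OF fh], of t] t by simp
    next
      fix \<rho> j and t :: real assume \<rho>: "labelling \<rho>" "lab \<rho> j = z" and t: "t \<in> \<I>"
      have \<tau>: "\<tau> = parity_gen j" using lab_parity[OF \<rho>] by (simp add: \<tau>_def)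
      show "value_at \<rho> w (of_int j / 2 - 1/2 + t) = of_int j / 2 - 1/2 + flip ?f t"
        unfolding w(2) act_apply[OF fh t \<tau>] using \<rho>(2) Neg by simp
    qed
  qed
qed

text \<open>Conjugation by the shifting word moves the action from the cell before each
  \<open>z\<close> to the cell after it. The copy of \<open>h\<close> is exact because the shift is
  a translation wherever \<open>h\<close> moves points.\<close>

lemma conjugate_element:
  assumes "encodes w v z h" "cell_map h" "w \<in> words"
  obtains w' where "w' \<in> words"
    "\<And>\<rho> j s. \<lbrakk>labelling \<rho>; lab \<rho> j = z; s \<in> {0..1/2}\<rbrakk>
      \<Longrightarrow> value_at \<rho> w' (of_int j / 2 - 1/2 + s) = of_int j / 2 - 1/2 + s"
    "\<And>\<rho> j s. \<lbrakk>labelling \<rho>; lab \<rho> j = z; s \<in> {0..1/2}\<rbrakk>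
      \<Longrightarrow> value_at \<rho> w' (of_int j / 2 + s) = of_int j / 2 + (if occurs \<rho> v (j - 1) then h s else s)"
proof -
  let ?M = "{3/16<..<5/16::real}"
  obtain g \<phi> where g: "g \<in> words" and \<phi>: "\<phi> \<in> carrier (homeo_plus \<I>)"
    and shift: "\<And>t. t \<in> {3/16..5/16} \<Longrightarrow> \<phi> t = t + 1/2"
    and gval: "\<And>\<rho> j t. \<lbrakk>labelling \<rho>; lab \<rho> j = z; t \<in> \<I>\<rbrakk>
      \<Longrightarrow> value_at \<rho> g (of_int j / 2 - 1/2 + t) = of_int j / 2 - 1/2 + \<phi> t"
    using shift_element by blast
  define w' where "w' = inv_word g @ w @ g"
  have w': "w' \<in> words" using g assms(3) words_inv[OF g] unfolding w'_def by (intro words_append)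
  \<comment> \<open>Points are written as \<open>\<phi> u\<close>, which the inverse shift takes to
    \<open>u\<close>. No formula for \<phi> outside the middle part is needed, as \<open>w\<close>
    fixes \<open>u\<close> there.\<close>
  have val: "value_at \<rho> w' (of_int j / 2 - 1/2 + \<phi> u) = of_int j / 2 - 1/2 +
      (if occurs \<rho> v (j - 1) \<and> u \<in> ?M then 1/2 + h u else \<phi> u)"
    if \<rho>: "labelling \<rho>" "lab \<rho> j = z" and u: "u \<in> \<I>" for \<rho> j u
  proof -
    let ?c = "of_int j / 2 - 1/2 :: real"
    have "value_at \<rho> (inv_word g) (?c + \<phi> u) = ?c + u"
      using value_inv(1)[OF g, of \<rho> "?c + u"] gval[OF \<rho> u] by simp
    moreover have "value_at \<rho> w (?c + u) = ?c + (if occurs \<rho> v (j - 1) \<and> u \<in> ?M then h u else u)"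
    proof (cases "u \<le> 1/2")
      case True
      then show ?thesis using encodesD(2)[OF assms(1) \<rho>, of u] u cell_map_outside[OF assms(2), of u]
        by auto
    next
      case False
      have c: "?c + u = of_int j / 2 + (u - 1/2)" by simp
      have "value_at \<rho> w (?c + u) = ?c + u"
        unfolding c by (rule encodesD(1)[OF assms(1) \<rho>]) (use u False in auto)
      then show ?thesis using False by auto
    qed
    moreover have "value_at \<rho> g (?c + (if occurs \<rho> v (j - 1) \<and> u \<in> ?M then h u else u))
        = ?c + (if occurs \<rho> v (j - 1) \<and> u \<in> ?M then 1/2 + h u else \<phi> u)"
    proof (cases "occurs \<rho> v (j - 1) \<and> u \<in> ?M")
      case True
      then have "h u \<in> ?M" using cell_map_inside[OF assms(2)] by blast
      then show ?thesis using gval[OF \<rho>, of "h u"] shift[of "h u"] True by auto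
    next
      case False
      then show ?thesis using gval[OF \<rho> u] by auto
    qed
    ultimately show ?thesis
      using value_append[OF words_inv[OF g] words_append[OF assms(3) g], of \<rho>]
        value_append[OF assms(3) g, of \<rho>]
      unfolding w'_def by simp
  qed
  have surj: "\<exists>u\<in>\<I>. \<phi> u = t" if "t \<in> \<I>" for t
  proof -
    have "\<phi> ` \<I> = \<I>" using \<phi> by (auto simp: homeo_plus_def homeo_def homeomorphism_def)
    then show ?thesis using that by (metis imageE)
  qed
  show thesis
  proof (rule that[OF w'])
    fix \<rho> j and s :: real assume \<rho>: "labelling \<rho>" "lab \<rho> j = z" and s: "s \<in> {0..1/2}"
    have "s \<in> \<I>" using s by auto
    then obtain u where u: "u \<in> \<I>" "\<phi> u = s" using surj by blast
    \<comment> \<open>The shift carries the middle part beyond 1/2, whereas \<open>s\<close> is at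
      most 1/2.\<close>
    have "u \<notin> ?M" using shift[of u] u(2) s by auto
    then show "value_at \<rho> w' (of_int j / 2 - 1/2 + s) = of_int j / 2 - 1/2 + s"
      using val[OF \<rho> u(1)] unfolding u(2) by (simp only: simp_thms if_False)
  next
    fix \<rho> j and s :: real assume \<rho>: "labelling \<rho>" "lab \<rho> j = z" and s: "s \<in> {0..1/2}"
    have s': "s + 1/2 \<in> \<I>" using s by auto
    have x: "of_int j / 2 + s = of_int j / 2 - 1/2 + (s + 1/2)" by simp
    show "value_at \<rho> w' (of_int j / 2 + s) = of_int j / 2 + (if occurs \<rho> v (j - 1) then h s else s)"
    proof (cases "s \<in> ?M")
      case True
      then have \<phi>s: "\<phi> s = s + 1/2" using shift[of s] by auto
      have "s \<in> \<I>" using s by auto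
      from val[OF \<rho> this] show ?thesis unfolding x \<phi>s using True by simp
    next
      case False
      obtain u where u: "u \<in> \<I>" "\<phi> u = s + 1/2" using surj[OF s'] by blast
      have "u \<notin> ?M" using shift[of u] u(2) False by auto
      then show ?thesis
        using val[OF \<rho> u(1)] cell_map_outside[OF assms(2) False]
        unfolding x u(2) by (simp only: simp_thms if_False if_cancel)
    qed
  qed
qed

section \<open>Commutators of words, cell by cell\<close>

lemma inverse_cell:
  assumes "w \<in> words" "cell_map h" "\<And>s. s \<in> {0..1/2} \<Longrightarrow> value_at \<rho> w (c + s) = c + h s"
    and "s \<in> {0..1/2}"
  shows "value_at \<rho> (inv_word w) (c + s) = c + inv_into UNIV h s"
proof -
  have "inv_into UNIV h s \<in> {0..1/2}" using cell_map_cell[OF cell_map_inv[OF assms(2)] assms(4)] .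
  moreover have "h (inv_into UNIV h s) = s" using cell_map_bij[OF assms(2)] by (simp add: bij_is_surj surj_f_inv_f)
  ultimately have "value_at \<rho> w (c + inv_into UNIV h s) = c + s" using assms(3) by simp
  then show ?thesis using value_inv(1)[OF assms(1), of \<rho> "c + inv_into UNIV h s"] by simp
qed

lemma commutator_cell:
  assumes w: "u \<in> words" "w \<in> words" and cm: "cell_map h" "cell_map f"
    and u: "\<And>s. s \<in> {0..1/2} \<Longrightarrow> value_at \<rho> u (c + s) = c + h s"
    and v: "\<And>s. s \<in> {0..1/2} \<Longrightarrow> value_at \<rho> w (c + s) = c + f s"
    and s: "s \<in> {0..1/2}"
  shows "value_at \<rho> (inv_word u @ inv_word w @ u @ w) (c + s) = c + commutator h f s"
proof -
  have 1: "inv_into UNIV h s \<in> {0..1/2}" using cell_map_cell[OF cell_map_inv[OF cm(1)] s] .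
  have 2: "inv_into UNIV f (inv_into UNIV h s) \<in> {0..1/2}" using cell_map_cell[OF cell_map_inv[OF cm(2)] 1] .
  have 3: "h (inv_into UNIV f (inv_into UNIV h s)) \<in> {0..1/2}" using cell_map_cell[OF cm(1) 2] .
  note uw = words_append[OF w] words_inv[OF w(1)] words_inv[OF w(2)]
  note words = uw words_append[OF uw(3,1)]
  have inv: "value_at \<rho> (inv_word u) (c + s) = c + inv_into UNIV h s"
    by (rule inverse_cell[OF w(1) cm(1) _ s]) (rule u)
  have inv': "value_at \<rho> (inv_word w) (c + inv_into UNIV h s) = c + inv_into UNIV f (inv_into UNIV h s)"
    by (rule inverse_cell[OF w(2) cm(2) _ 1]) (rule v)
  show ?thesis
    unfolding value_append[OF words(2,4)] value_append[OF words(3,1)] value_append[OF w]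
inv inv' u[OF 2] v[OF 3]
      commutator_def ..
qed

lemma other_generator:
  assumes "labelling \<rho>" "gen_of (lab \<rho> j) \<noteq> gen_of z" "odd (i - j)"
  shows "lab \<rho> i = z \<or> lab \<rho> i = inv_letter z"
proof -
  have "gen_of (lab \<rho> i) \<noteq> gen_of (lab \<rho> j)"
    using gen_of_lab[OF assms(1)] assms(3) by simp
  then have "gen_of (lab \<rho> i) = gen_of z" using assms(2) ab.exhaust by metis
  then show ?thesis by (cases z; cases "lab \<rho> i") auto
qed

text \<open>The inductive step. Next to a letter \<open>z'\<close>, the conjugated word
  \<open>g\<close> meets the base word \<open>u\<close> in a common cell only if \<open>z'\<close>
  directly follows a \<open>z\<close> that completes an occurrence of \<open>z # v\<close>. In the
  other cells there, one of the two acts trivially, and so does their commutator.\<close>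

lemma extend_pattern:
  assumes w: "w \<in> words" and enc: "encodes w v z h" and h: "cell_map h" "h p \<noteq> p"
    and z': "gen_of z' \<noteq> gen_of z"
  obtains w' h' q where "w' \<in> words" "encodes w' (z # v) z' h'" "cell_map h'" "h' q \<noteq> q"
proof -
  let ?M = "{3/16<..<5/16::real}"
  have "p \<in> ?M" using cell_map_outside[OF h(1)] h(2) by blast
  then have hp: "h p \<in> ?M" by (rule cell_map_inside[OF h(1)])
  \<comment> \<open>These bounds leave room for a dyadic interval around \<open>h p\<close> that
    omits \<open>p\<close>. A bump on it fixes \<open>p\<close> and moves \<open>h p\<close>, as
    \<open>commutator_moves\<close> requires.\<close>
  define lo hi where "lo = (if p < h p then max p (3/16) else 3/16)"
    and "hi = (if h p < p then min p (5/16) else 5/16)"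
  have "lo < h p" "h p < hi" using hp by (auto simp: lo_def hi_def)
  then obtain a b where ab: "a \<in> dyadic" "lo < a" "a < h p" "b \<in> dyadic" "h p < b" "b < hi"
    using dyadic_dense by metis
  have p: "p \<notin> {a<..<b}" using ab h(2) by (auto simp: lo_def hi_def split: if_splits)
  have "3/16 \<le> lo" "hi \<le> 5/16" unfolding lo_def hi_def by (auto simp: max_def min_def)
  then have "0 < b - a" "3/16 \<le> a" "a + (b - a) \<le> 5/16" using ab by linarith+
  then obtain u f where u: "u \<in> words" "encodes u [] z' f" and f: "cell_map f"
    and moves: "\<And>s. f s \<noteq> s \<longleftrightarrow> s \<in> {a<..<a + (b - a)}"
    by (rule left_element[OF ab(1) dyadic_diff[OF ab(4,1)], of z']) blast+
  have fp: "f p = p" "f (h p) \<noteq> h p" using moves[of p] moves[of "h p"] p ab by auto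
  obtain g where g: "g \<in> words"
    and g_left: "\<And>\<rho> j s. \<lbrakk>labelling \<rho>; lab \<rho> j = z; s \<in> {0..1/2}\<rbrakk>
      \<Longrightarrow> value_at \<rho> g (of_int j / 2 - 1/2 + s) = of_int j / 2 - 1/2 + s"
    and g_right: "\<And>\<rho> j s. \<lbrakk>labelling \<rho>; lab \<rho> j = z; s \<in> {0..1/2}\<rbrakk>
      \<Longrightarrow> value_at \<rho> g (of_int j / 2 + s) = of_int j / 2 + (if occurs \<rho> v (j - 1) then h s else s)"
    using conjugate_element[OF enc h(1) w] by blast
  let ?w = "inv_word g @ inv_word u @ g @ u"
  show thesis
  proof (rule that)
    show "?w \<in> words" by (intro words_append words_inv g u(1))
    show "cell_map (commutator h f)" using cell_map_commutator[OF h(1) f] .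
    show "commutator h f (h p) \<noteq> h p"
      using commutator_moves cell_map_bij[OF h(1)] cell_map_bij[OF f] fp by blast
    show "encodes ?w (z # v) z' (commutator h f)"
      unfolding encodes_def
    proof (intro allI impI ballI conjI)
      fix \<rho> j and s :: real assume \<rho>: "labelling \<rho>" and j: "lab \<rho> j = z'" and s: "s \<in> {0..1/2}"
      note \<rho>' = labelling_reflect[OF \<rho>]
      have reflect: "value_at \<rho> g x = - value_at (reflect \<rho>) g (- x)" for x
        using value_reflect[OF \<rho> g, of x] by simp
      have "gen_of (lab \<rho> j) \<noteq> gen_of z" using j z' by simp
      \<comment> \<open>Letters alternate between the generators, so each neighbour of
        \<open>z'\<close> is \<open>z\<close> or its inverse.\<close>
      then have sides: "lab \<rho> (j - 1) = z \<or> lab \<rho> (j - 1) = inv_letter z"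
        "lab \<rho> (j + 1) = z \<or> lab \<rho> (j + 1) = inv_letter z"
        using other_generator[OF \<rho>] by auto
      let ?c = "of_int j / 2 - 1/2 :: real"
      let ?k = "if occurs \<rho> (z # v) (j - 1) then h else (\<lambda>s. s)"
      have "value_at \<rho> g (?c + s) = ?c + ?k s" if s: "s \<in> {0..1/2}" for s
        using sides(1)
      proof
        assume z: "lab \<rho> (j - 1) = z"
        have c: "?c = of_int (j - 1) / 2" by (simp add: diff_divide_distrib)
        show ?thesis unfolding c using g_right[OF \<rho> z s] z by simp
      next
        \<comment> \<open>Reflection turns the cell after this inverse letter into the cell before a
          \<open>z\<close>, where \<open>g\<close> is trivial.\<close>
        assume z: "lab \<rho> (j - 1) = inv_letter z"
        then have "lab (reflect \<rho>) (1 - j) = z" by (simp add: lab_reflect)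
        moreover have "1/2 - s \<in> {0..1/2}" using s by simp
        moreover have "- (?c + s) = of_int (1 - j) / 2 - 1/2 + (1/2 - s)" by (simp add: diff_divide_distrib)
        ultimately have "value_at (reflect \<rho>) g (- (?c + s)) = - (?c + s)"
          using g_left[OF \<rho>'] by metis
        moreover have "lab \<rho> (j - 1) \<noteq> z" using z inv_letter_neq by metis
        ultimately show ?thesis using reflect[of "?c + s"] by simp
      qed
      moreover have "value_at \<rho> u (?c + s) = ?c + f s" if s: "s \<in> {0..1/2}" for s
        using encodesD(2)[OF u(2) \<rho> j s] by simp
      moreover have "cell_map ?k" using h(1) cell_map_id by simp
      ultimately have "value_at \<rho> ?w (?c + s) = ?c + commutator ?k f s"
        using s by (intro commutator_cell[OF g u(1) _ f])
      moreover have "commutator (\<lambda>s. s) f s = s"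
        using cell_map_bij[OF f] by (simp add: commutator_def inv_id[unfolded id_def] bij_is_surj surj_f_inv_f)
      ultimately show "value_at \<rho> ?w (?c + s)
          = ?c + (if occurs \<rho> (z # v) (j - 1) then commutator h f s else s)"
        by (simp split: if_splits)
      let ?d = "of_int j / 2 :: real"
      \<comment> \<open>In the cell after \<open>z'\<close> the word \<open>u\<close> is trivial, so
        it suffices that \<open>g\<close> acts there by some cell map. Before a \<open>z\<close>
        this is the identity; before its inverse it may be a reflected copy of
        \<open>h\<close>.\<close>
      obtain k where k: "cell_map k" "\<And>s. s \<in> {0..1/2} \<Longrightarrow> value_at \<rho> g (?d + s) = ?d + k s"
      proof (cases "lab \<rho> (j + 1) = z")
        case True
        have d: "?d = of_int (j + 1) / 2 - 1/2" by (simp add: add_divide_distrib)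
        show thesis
        proof (rule that[OF cell_map_id])
          show "value_at \<rho> g (?d + s) = ?d + s" if "s \<in> {0..1/2}" for s
            unfolding d by (rule g_left[OF \<rho> True that])
        qed
      next
        case False
        let ?r = "if occurs (reflect \<rho>) v (- (j + 1) - 1) then h else (\<lambda>s. s)"
        have z: "lab (reflect \<rho>) (- (j + 1)) = z"
          using False sides(2) by (simp add: lab_reflect add.commute)
        have r: "cell_map ?r" using h(1) cell_map_id by simp
        show thesis
        proof (rule that[OF cell_map_reflect[OF r]])
          fix s :: real assume "s \<in> {0..1/2}"
          then have "1/2 - s \<in> {0..1/2}" by simp
          note at_z = g_right[OF \<rho>' z this]
          have x: "- (?d + s) = of_int (- (j + 1)) / 2 + (1/2 - s)" by (simp add: diff_divide_distrib)
          have "value_at (reflect \<rho>) g (- (?d + s)) = of_int (- (j + 1)) / 2 + ?r (1/2 - s)"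
            unfolding x at_z by simp
          then show "value_at \<rho> g (?d + s) = ?d + (1/2 - ?r (1/2 - s))"
            using reflect[of "?d + s"] by (simp add: diff_divide_distrib)
        qed
      qed
      have "value_at \<rho> u (?d + s) = ?d + s" if s: "s \<in> {0..1/2}" for s
        using encodesD(1)[OF u(2) \<rho> j s] .
      then have "value_at \<rho> ?w (?d + s) = ?d + commutator k (\<lambda>s. s) s"
        using s by (intro commutator_cell[OF g u(1) k(1) cell_map_id k(2)])
      also have "commutator k (\<lambda>s. s) s = s"
        using cell_map_bij[OF k(1)] by (simp add: commutator_def inv_id[unfolded id_def] bij_is_surj surj_f_inv_f)
      finally show "value_at \<rho> ?w (?d + s) = ?d + s" .
    qed
  qed
qed

text \<open>The occurrence ensures that consecutive letters of the pattern have different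
  generators, as \<open>extend_pattern\<close> requires. The word obtained detects the pattern in
  every labelling.\<close>

lemma pattern_word:
  assumes "labelling \<rho>" "occurs \<rho> (z # v) j"
  shows "\<exists>w\<in>words. \<exists>h p. encodes w v z h \<and> cell_map h \<and> h p \<noteq> p"
  using assms(2)
proof (induction v arbitrary: z j)
  case Nil
  \<comment> \<open>The base case takes a small dyadic interval within the middle part; the moved
    point chosen below is its midpoint.\<close>
  have d: "1/4 \<in> dyadic" "1/32 \<in> dyadic"
    using dyadicI[of "1/4" 1 2] dyadicI[of "1/32" 1 5] by simp_all
  have l: "0 < (1/32 :: real)" "3/16 \<le> (1/4 :: real)" "1/4 + 1/32 \<le> (5/16 :: real)" by simp_all
  show ?case
  proof (rule left_element[OF d l, of z])
    fix w h assume wh: "w \<in> words" "cell_map h" "encodes w [] z h"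
      and moves: "\<And>s. h s \<noteq> s \<longleftrightarrow> s \<in> {1/4<..<1/4 + 1/32}"
    have "h (1/4 + 1/64) \<noteq> 1/4 + 1/64" unfolding moves by simp
    then show ?case using wh by blast
  qed
next
  case (Cons y v)
  have "occurs \<rho> (y # v) (j - 1)" using Cons.prems by simp
  then obtain w h p where whp: "w \<in> words" "encodes w v y h" "cell_map h" "h p \<noteq> p"
    using Cons.IH by blast
  have "lab \<rho> j = z" "lab \<rho> (j - 1) = y" using Cons.prems by simp_all
  then have "gen_of z \<noteq> gen_of y"
    using gen_of_lab[OF assms(1), of j] gen_of_lab[OF assms(1), of "j - 1"] by auto
  from extend_pattern[OF whp this] show ?case by metis
qed

section \<open>Triviality of the detecting word and occurrence of the pattern\<close>

lemma encodes_occurs: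
  assumes "encodes w v z h" "labelling \<rho>" "occurs \<rho> (z # v) j" "cell_map h" "h p \<noteq> p"
  shows "value_at \<rho> w (of_int j / 2 - 1/2 + p) \<noteq> of_int j / 2 - 1/2 + p"
proof -
  have "p \<in> {3/16<..<5/16}" using cell_map_outside[OF assms(4)] assms(5) by blast
  then have "p \<in> {0..1/2}" by simp
  then show ?thesis using encodesD(2)[OF assms(1,2)] assms(3,5) by simp
qed

text \<open>The unit intervals centred at letters \<open>z\<close> and at their inverses cover the
  line. On the former \<open>encodes\<close> applies directly, on the latter after reflection, which
  is why the pattern has to be absent from both labellings.\<close>

lemma encodes_not_occurs:
  assumes w: "w \<in> words" "encodes w v z h" and \<rho>: "labelling \<rho>"
    and no: "\<And>i. \<not> occurs \<rho> (z # v) i" "\<And>i. \<not> occurs (reflect \<rho>) (z # v) i"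
  shows "value_at \<rho> w x = x"
proof -
  have fixed: "value_at \<rho> w (of_int j / 2 - 1/2 + t) = of_int j / 2 - 1/2 + t"
    if "labelling \<rho>" "\<not> occurs \<rho> (z # v) j" "lab \<rho> j = z" "t \<in> \<I>" for \<rho> j t
  proof (cases "t \<le> 1/2")
    case True
    then show ?thesis using encodesD(2)[OF w(2) that(1,3), of t] that(2-4) by simp
  next
    case False
    have c: "of_int j / 2 - 1/2 + t = of_int j / 2 + (t - 1/2)" by simp
    show ?thesis
      unfolding c by (rule encodesD(1)[OF w(2) that(1,3)]) (use that(4) False in auto)
  qed
  obtain j t where jt: "gen_of z = parity_gen j" "t \<in> \<I>" "x = of_int j / 2 - 1/2 + t"
    by (rule centred_coordinates)
  have "gen_of (lab \<rho> j) = gen_of z" using gen_of_lab[OF \<rho>] jt(1) by simp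
  then consider "lab \<rho> j = z" | "lab \<rho> j = inv_letter z" by (cases z; cases "lab \<rho> j") auto
  then show ?thesis
  proof cases
    case 1
    then show ?thesis unfolding jt(3) using fixed[OF \<rho> no(1) _ jt(2)] by blast
  next
    case 2
    then have "lab (reflect \<rho>) (- j) = z" by (simp add: lab_reflect)
    moreover have "1 - t \<in> \<I>" using jt(2) by simp
    moreover have "- x = of_int (- j) / 2 - 1/2 + (1 - t)" using jt(3) by simp
    ultimately have "value_at (reflect \<rho>) w (- x) = - x"
      using fixed[OF labelling_reflect[OF \<rho>] no(2)] by metis
    then show ?thesis using value_reflect[OF \<rho> w(1), of x] by simp
  qed
qed

end

section \<open>Passing to periodic labellings\<close>

lemma (in thompson_generators) not_finitely_presentable:
  assumes "finite N" and \<rho>: "labelling \<rho>" and qp: "quasi_periodic \<rho>"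
  shows "\<not> finitely_presentable
    (subgroup_generated (homeo_plus UNIV) ((\<lambda>(\<tau>, f). act \<tau> \<rho> f) ` (UNIV \<times> N)))"
    (is "\<not> finitely_presentable ?G")
proof
  let ?K = "homeo_plus UNIV :: (real \<Rightarrow> real) monoid"
  let ?g = "\<lambda>\<rho> (\<tau>, f). act \<tau> \<rho> f"
  let ?I = "(UNIV :: ab set) \<times> N"
  assume fp: "finitely_presentable ?G"
  interpret K: group ?K by (rule group_homeo_plus)
  have G: "group ?G" by simp
  interpret G: group ?G by (rule G)
  have "finite (UNIV :: ab set)"
    by (rule finite_subset[of _ "{gen_a, gen_b}"]) (use ab.exhaust in auto)
  then have I: "finite ?I" using assms(1) by (rule finite_cartesian_product)
  have sub: "?g \<rho> ` ?I \<subseteq> carrier ?K" using act_closed by blast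
  then have gG: "?g \<rho> ` ?I \<subseteq> carrier ?G" by (rule K.subgroup_generated_subset_carrier_subset)
  then have g: "?g \<rho> \<in> ?I \<rightarrow> carrier ?G" by auto
  have "carrier ?G = carrier (subgroup_generated ?G (?g \<rho> ` ?I))" by simp
  also have "\<dots> = generate ?G (?g \<rho> ` ?I)"
    unfolding carrier_subgroup_generated[of ?G] using gG by (simp add: Int_absorb1)
  finally have gen: "carrier ?G = generate ?G (?g \<rho> ` ?I)" .
  \<comment> \<open>Through the inclusion, a word has the same value in the subgroup as in the full
    homeomorphism group.\<close>
  have incl: "(\<lambda>f. f) \<in> hom ?G ?K"
    using K.carrier_subgroup_generated_subset by (intro homI) (auto simp: subgroup_generated_def)
  have valG: "word_value ?G (?g \<rho>) w = value_at \<rho> w" if "w \<in> words" for w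
    using G.word_value_hom[OF K.is_group incl g, of w] that by simp
  obtain Q where Q: "finite Q" "\<And>q. q \<in> Q \<Longrightarrow> gen_of ` set q \<subseteq> ?I"
      "\<And>q. q \<in> Q \<Longrightarrow> word_value ?G (?g \<rho>) q = \<one>\<^bsub>?G\<^esub>"
    and imp: "\<And>(K :: (real \<Rightarrow> real) monoid) k w.
       \<lbrakk>group K; k \<in> ?I \<rightarrow> carrier K; \<And>q. q \<in> Q \<Longrightarrow> word_value K k q = \<one>\<^bsub>K\<^esub>;
        gen_of ` set w \<subseteq> ?I; word_value ?G (?g \<rho>) w = \<one>\<^bsub>?G\<^esub>\<rbrakk> \<Longrightarrow> word_value K k w = \<one>\<^bsub>K\<^esub>"
    by (rule finitely_presentable_relators[OF fp G I g gen]) blast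
  obtain L where L: "\<And>q. q \<in> Q \<Longrightarrow> length q \<le> L"
    using finite_nat_set_iff_bounded_le[of "length ` Q"] Q(1) by auto
  \<comment> \<open>Labels within distance \<open>L\<close> of \<open>x\<close> have indices between
    \<open>2x - 2L\<close> and \<open>2x + 2L\<close>; the window of \<open>4L + 2\<close> letters
    starting at the floor of \<open>2x\<close> minus \<open>2L\<close> contains them all.\<close>
  obtain \<rho>' u j where \<rho>': "labelling \<rho>'"
    and window: "\<And>i. \<exists>d. even d \<and> (\<forall>t\<le>4 * L + 1. lab \<rho>' (i + int t) = lab \<rho> (i + int t + d))"
    and u: "u \<noteq> []" "occurs \<rho>' u j" "\<And>i. \<not> occurs \<rho> u i" "\<And>i. \<not> occurs (reflect \<rho>) u i"
    by (rule quasi_periodic_approximation[OF \<rho> qp, of "4 * L + 1"]) blast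
  \<comment> \<open>Around each point \<rho>' is an even shift of \<rho>, on a radius that no
    relator exceeds in length, so \<open>value_local\<close> carries triviality over to
    \<rho>'.\<close>
  have Q': "word_value ?K (?g \<rho>') q = \<one>\<^bsub>?K\<^esub>" if q: "q \<in> Q" for q
  proof -
    have "value_at \<rho>' q x = x" for x
    proof -
      define i where "i = \<lfloor>2 * x\<rfloor> - 2 * int L"
      obtain d where d: "even d" "\<And>t. t \<le> 4 * L + 1 \<Longrightarrow> lab \<rho>' (i + int t) = lab \<rho> (i + int t + d)"
        using window[of i] by blast
      then obtain m where m: "d = 2 * m" by (auto elim: evenE)
      have "value_at \<rho> q (x + of_int m) = value_at \<rho>' q x + of_int m"
      proof (rule value_local)
        fix k assume "\<bar>of_int k / 2 - x\<bar> \<le> real (length q)"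
        then have "\<bar>of_int k / 2 - x\<bar> \<le> real L" using L[OF q] by simp
        then have "i \<le> k" "k \<le> i + int (4 * L + 1)" unfolding i_def by (simp_all add: abs_le_iff) linarith+
        then show "lab \<rho>' k = lab \<rho> (k + 2 * m)" using d(2)[of "nat (k - i)"] by (simp add: m)
      qed (use Q(2)[OF q] in simp)
      moreover have "value_at \<rho> q = (\<lambda>x. x)" using valG[of q] Q(2,3)[OF q] by simp
      ultimately show ?thesis by simp
    qed
    then show ?thesis by auto
  qed
  obtain z v where zv: "u = z # v" using u(1) by (cases u) auto
  obtain w h p where w: "w \<in> words" "encodes w v z h" and h: "cell_map h" "h p \<noteq> p"
    using pattern_word[OF \<rho>' u(2)[unfolded zv]] by blast
  have "value_at \<rho> w x = x" for x
    using encodes_not_occurs[OF w \<rho>] u(3,4) zv by blast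
  then have "word_value ?G (?g \<rho>) w = \<one>\<^bsub>?G\<^esub>" using valG[OF w(1)] by auto
  \<comment> \<open>All relations of \<open>?G\<close> follow from those in \<open>Q\<close>, so
    they hold for \<rho>' too; but \<open>w\<close> moves a point where the pattern occurs in
    \<rho>'.\<close>
  then have "value_at \<rho>' w = \<one>\<^bsub>?K\<^esub>"
    using imp[OF K.is_group act_closed Q'] w(1) by blast
  then show False
    using encodes_occurs[OF w(2) \<rho>' _ h, of j] u(2) zv by simp
qed

theorem theorem1p1:
  fixes c\<^sub>0 \<nu>\<^sub>2 \<nu>\<^sub>3 :: "real \<Rightarrow> real" and \<rho> :: "real \<Rightarrow> ab letter"
  assumes "c\<^sub>0 \<in> thompson_F"
    and "supp \<I> c\<^sub>0 = {0<..<1/4}"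
    and "\<forall>x\<in>{0<..<1/4}. c\<^sub>0 x > x"
    and "\<forall>t\<in>{0<..<1/16}. c\<^sub>0 t = 2 * t"
    and "\<nu>\<^sub>2 \<in> carrier (homeo \<I>)" and "supp \<I> \<nu>\<^sub>2 \<subseteq> {1/16<..<15/16}"
    and "\<nu>\<^sub>3 \<in> carrier (homeo \<I>)" and "supp \<I> \<nu>\<^sub>3 \<subseteq> {1/16<..<15/16}"
    and "generate (homeo \<I>) {\<nu>\<^sub>2, \<nu>\<^sub>3} = thompson_F_on (1/16) (15/16)"
    and "labelling \<rho>"
    and "quasi_periodic \<rho>"
  shows "\<not> finitely_presentable (G_rho \<rho> (nu1 c\<^sub>0) \<nu>\<^sub>2 \<nu>\<^sub>3)"
proof -
  interpret H: group "homeo \<I>" by (rule group_homeo)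
  let ?N = "{nu1 c\<^sub>0, \<nu>\<^sub>2, \<nu>\<^sub>3}"
  have "c\<^sub>0 \<in> carrier (homeo_plus \<I>)" using assms(1) by (simp add: thompson_F_def)
  then have "nu1 c\<^sub>0 \<in> carrier (homeo_plus \<I>)" by (rule nu1_homeo_plus)
  moreover have "{\<nu>\<^sub>2, \<nu>\<^sub>3} \<subseteq> thompson_F_on (1/16) (15/16)"
    unfolding assms(9)[symmetric] by (auto intro: generate.incl)
  then have "{\<nu>\<^sub>2, \<nu>\<^sub>3} \<subseteq> carrier (homeo_plus \<I>)" by (auto simp: thompson_F_on_def thompson_F_def)
  ultimately have "?N \<subseteq> carrier (homeo_plus \<I>)" by simp
  \<comment> \<open>The subgroup property is inherited from the generated subgroup, which avoids any
    computation with compositions of piecewise linear maps.\<close>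
  moreover have "subgroup (thompson_F_on (1/16) (15/16)) (homeo \<I>)"
    unfolding assms(9)[symmetric] using assms(5,7) by (intro H.generate_is_subgroup) simp
  moreover have "thompson_F_on (1/16) (15/16) \<subseteq> generate (homeo \<I>) ?N"
    unfolding assms(9)[symmetric] by (rule H.mono_generate) auto
  ultimately interpret thompson_generators ?N by (rule thompson_generators.intro)
  have "(UNIV :: ab set) \<times> ?N = Pair gen_a ` ?N \<union> Pair gen_b ` ?N" using ab.exhaust by auto
  then have "(\<lambda>(\<tau>, f). act \<tau> \<rho> f) ` (UNIV \<times> ?N)
      = {zeta \<rho> (nu1 c\<^sub>0), zeta \<rho> \<nu>\<^sub>2, zeta \<rho> \<nu>\<^sub>3, chi \<rho> (nu1 c\<^sub>0), chi \<rho> \<nu>\<^sub>2, chi \<rho> \<nu>\<^sub>3}"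
    by (simp only: image_Un image_image image_insert image_empty prod.case act_def ab.case) auto
  then show ?thesis
    using not_finitely_presentable[OF _ assms(10,11)] by (simp add: G_rho_def)
qed

end
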